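(* Let $n\ge 2$ be an integer, let $J_0\subset\mathbb{R}$ be a finite open interval, and let $\varphi:J_0\to\mathbb{R}$ be continuously differentiable with $$\sup_{x\in J_0}|\varphi'(x)|=c_6<\infty,\qquad \#\{x\in J_0:\varphi(x)=x\}=c_7<\infty .$$ Let $J\subset J_0$ be an interval and let $0<\gamma<1$. For a constant $c_1>0$ and real $Q>1$ put $$M^n_\varphi(Q,\gamma,J)=\{\boldsymbol\alpha=(\alpha_1,\alpha_2)\in\mathcal{A}_n^2(Q):\ \alpha_1\in J,\ |\varphi(\alpha_1)-\alpha_2|<c_1Q^{-\gamma}\}.$$ Then, for all sufficiently large $c_1$, there exist constants $c_2,c_3>0$, independent of $Q$, and $Q_0=Q_0(n,J,\varphi,\gamma)$ such that for all $Q>Q_0$ $$c_2\,Q^{n+1-\gamma}<\#M^n_\varphi(Q,\gamma,J)<c_3\,Q^{n+1-\gamma}.$$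
   Context: For $P(t)=a_mt^m+\dots+a_0\in\mathbb{Z}[t]$, the height is $H(P)=\max_j|a_j|$. A point $\boldsymbol\alpha=(\alpha_1,\alpha_2)\in\mathbb{C}^2$ is an algebraic point if $\alpha_1\neq\alpha_2$ are roots of the same irreducible polynomial in $\mathbb{Z}[t]$; its minimal polynomial is the polynomial $P\in\mathbb{Z}[t]$ of smallest degree (necessarily $\ge 2$) with coprime coefficients such that $P(\alpha_1)=P(\alpha_2)=0$, and $\deg\boldsymbol\alpha=\deg P$, $H(\boldsymbol\alpha)=H(P)$. $\mathcal{A}_n^2(Q)$ denotes the set of algebraic points $\boldsymbol\alpha$ with $\deg\boldsymbol\alpha\le n$ and $H(\boldsymbol\alpha)\le Q$. $\#S$ is the cardinality of $S$. *)

theory Defs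
  imports "HOL-Analysis.Analysis" "HOL-Computational_Algebra.Computational_Algebra"
begin

definition poly_height :: "int poly \<Rightarrow> int" where
  "poly_height P = Max ((\<lambda>j. \<bar>coeff P j\<bar>) ` {..degree P})"

definition common_root_poly :: "complex \<times> complex \<Rightarrow> int poly \<Rightarrow> bool" where
  "common_root_poly \<alpha> P \<longleftrightarrow>
     poly (map_poly of_int P) (fst \<alpha>) = 0 \<and> poly (map_poly of_int P) (snd \<alpha>) = 0"

definition algebraic_point :: "complex \<times> complex \<Rightarrow> bool" where
  "algebraic_point \<alpha> \<longleftrightarrow>
     fst \<alpha> \<noteq> snd \<alpha> \<and> (\<exists>P. irreducible P \<and> common_root_poly \<alpha> P)"

definition is_minimal_poly :: "complex \<times> complex \<Rightarrow> int poly \<Rightarrow> bool" where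
  "is_minimal_poly \<alpha> P \<longleftrightarrow>
     content P = 1 \<and> common_root_poly \<alpha> P \<and>
     (\<forall>R. content R = 1 \<and> common_root_poly \<alpha> R \<longrightarrow> degree P \<le> degree R)"

text \<open>
  The minimal polynomial of an algebraic point is determined only up to sign; degree and height do
  not depend on the choice. Off the algebraic points the value is irrelevant.
\<close>

definition minimal_poly :: "complex \<times> complex \<Rightarrow> int poly" where
  "minimal_poly \<alpha> = (SOME P. is_minimal_poly \<alpha> P)"

definition point_degree :: "complex \<times> complex \<Rightarrow> nat" where
  "point_degree \<alpha> = degree (minimal_poly \<alpha>)"

definition point_height :: "complex \<times> complex \<Rightarrow> int" where
  "point_height \<alpha> = poly_height (minimal_poly \<alpha>)"

definition algebraic_points :: "nat \<Rightarrow> real \<Rightarrow> (complex \<times> complex) set" where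
  "algebraic_points n Q =
     {\<alpha>. algebraic_point \<alpha> \<and> point_degree \<alpha> \<le> n \<and> real_of_int (point_height \<alpha>) \<le> Q}"

text \<open>
  The first coordinate is required to be a real number lying in \<open>J\<close>, so \<open>Re\<close> merely retrieves it
  as an argument for \<open>\<phi>\<close>; the second coordinate may be non-real.
\<close>

definition points_near_curve ::
    "real \<Rightarrow> (real \<Rightarrow> real) \<Rightarrow> nat \<Rightarrow> real \<Rightarrow> real \<Rightarrow> real set \<Rightarrow> (complex \<times> complex) set" where
  "points_near_curve c\<^sub>1 \<phi> n Q \<gamma> J =
     {\<alpha> \<in> algebraic_points n Q. fst \<alpha> \<in> complex_of_real ` J \<and>
        cmod (complex_of_real (\<phi> (Re (fst \<alpha>))) - snd \<alpha>) < c\<^sub>1 * Q powr (- \<gamma>)}"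

end

theory Submission imports Defs "HOL-Real_Asymp.Real_Asymp" begin

text \<open>
  Write \<open>s = Q powr (- \<gamma>)\<close> and cut \<open>J\<close> into about \<open>1 / s\<close> cells of length \<open>s\<close>; it suffices to see
  order \<open>Q\<^sup>n\<^sup>-\<^sup>1 (Q s)\<^sup>2\<close> points over each cell.

  Upper bound. If \<open>P\<close> vanishes at two distinct points within \<open>O(s)\<close> of \<open>x\<close> and \<open>y\<close>, then both \<open>P(x)\<close> and the
  divided difference \<open>P[x, y]\<close> are \<open>O(Q s)\<close>. As \<open>P[x, y] = a\<^sub>1 + \<dots>\<close> and \<open>P(x) = a\<^sub>0 + a\<^sub>1 x + \<dots>\<close>, the
  coefficients of degree at least 2 confine \<open>a\<^sub>1\<close> and then \<open>a\<^sub>0\<close> to intervals of length \<open>O(Q s)\<close>; using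
  \<open>P[x, y]\<close> instead of \<open>P(y)\<close> makes this uniform near the diagonal.

  Lower bound. On a compact subinterval where \<open>\<phi>\<close> stays away from the identity, take \<open>y = \<phi>(x)\<close>, choose
  the coefficients of degree at least 2 freely with \<open>a\<^sub>2\<close> dominating, and let \<open>a\<^sub>1\<close>, \<open>a\<^sub>0\<close> run through windows
  of length of order \<open>Q s\<close> around the values that make \<open>P\<close> vanish at \<open>x\<close> and \<open>y\<close>. Then \<open>P\<close> is of size
  \<open>O(Q s)\<close> while its derivative is of order \<open>Q\<close> at both points, so \<open>P\<close> has roots within \<open>O(s)\<close> of them.
  Congruences modulo 4 make \<open>P\<close> an Eisenstein polynomial at 2. It is also primitive for a positive
  proportion of the pairs \<open>(a\<^sub>1, a\<^sub>0)\<close>: the leading coefficient is odd with \<open>O(log Q)\<close> prime factors,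
  and the odd primes \<open>q\<close> satisfy \<open>\<Sum> 1 / q\<^sup>2 \<le> 1 / 4\<close>.
\<close>

section \<open>Minimal polynomials of algebraic points\<close>

lemma poly_map_of_int_sum:
  fixes z :: "'a::{comm_ring_1,ring_char_0}"
  assumes "degree P \<le> n"
  shows "poly (map_poly of_int P) z = (\<Sum>j\<le>n. of_int (coeff P j) * z ^ j)"
proof -
  have "degree (map_poly of_int P :: 'a poly) \<le> n"
    using assms by (intro degree_le) (auto simp: coeff_map_poly coeff_eq_0)
  then have "poly (map_poly of_int P) z
      = poly (\<Sum>j\<le>n. monom (coeff (map_poly of_int P :: 'a poly) j) j) z"
    by (simp add: poly_as_sum_of_monoms')
  then show ?thesis by (simp add: poly_sum poly_monom coeff_map_poly)
qed

lemma poly_map_of_int_of_real: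
  "poly (map_poly of_int P) (complex_of_real x) = complex_of_real (poly (map_poly of_int P) x)"
  by (simp add: poly_map_of_int_sum[OF order_refl])

lemma common_root_poly_smult_cancel:
  assumes "common_root_poly \<alpha> (smult c P)" "c \<noteq> 0"
  shows "common_root_poly \<alpha> P"
  using assms by (simp add: common_root_poly_def map_poly_smult)

lemma common_root_poly_primitive_part:
  assumes "common_root_poly \<alpha> P" "P \<noteq> 0"
  shows "common_root_poly \<alpha> (primitive_part P)"
  using assms common_root_poly_smult_cancel[of \<alpha> "content P" "primitive_part P"] by simp

lemma poly_map_of_int_mult:
  "poly (map_poly of_int (P * R)) z
     = poly (map_poly of_int P) z * poly (map_poly of_int R) (z::'a::{comm_ring_1,ring_char_0})"
proof -
  have "map_poly of_int (P * R) = (map_poly of_int P * map_poly of_int R :: 'a poly)"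
    by (rule poly_eqI) (simp add: coeff_map_poly coeff_mult)
  then show ?thesis by simp
qed

lemma poly_map_of_int_add:
  "poly (map_poly of_int (P + R)) z
     = poly (map_poly of_int P) z + poly (map_poly of_int R) (z::'a::{comm_ring_1,ring_char_0})"
proof -
  have "map_poly of_int (P + R) = (map_poly of_int P + map_poly of_int R :: 'a poly)"
    by (rule poly_eqI) (simp add: coeff_map_poly)
  then show ?thesis by simp
qed

lemma is_minimal_poly_dvd:
  assumes R: "is_minimal_poly \<alpha> R" and P: "common_root_poly \<alpha> P"
  shows "R dvd P"
proof -
  have R0: "R \<noteq> 0" and cR: "content R = 1" and rR: "common_root_poly \<alpha> R"
    using R by (auto simp: is_minimal_poly_def)
  \<comment> \<open>The pseudo-remainder inherits the common roots, so minimality of the degree forces it to vanish.\<close>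
  obtain q r where qr: "pseudo_divmod P R = (q, r)" by force
  define c where "c = lead_coeff R ^ (Suc (degree P) - degree R)"
  have c0: "c \<noteq> 0" using R0 by (simp add: c_def)
  have eq: "smult c P = R * q + r" and deg: "r = 0 \<or> degree r < degree R"
    using pseudo_divmod[OF R0 qr] by (auto simp: c_def)
  have *: "poly (map_poly of_int (smult c P)) z
      = poly (map_poly of_int R) z * poly (map_poly of_int q) z + poly (map_poly of_int r) z" for z :: complex
    by (simp add: eq poly_map_of_int_add poly_map_of_int_mult)
  have r: "common_root_poly \<alpha> r"
    using P rR *[of "fst \<alpha>"] *[of "snd \<alpha>"] by (simp add: common_root_poly_def map_poly_smult)
  have "r = 0"
  proof (rule ccontr)
    assume "r \<noteq> 0"
    then have "content (primitive_part r) = 1" by simp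
    then have "degree R \<le> degree (primitive_part r)"
      using R common_root_poly_primitive_part[OF r \<open>r \<noteq> 0\<close>] unfolding is_minimal_poly_def by blast
    with deg \<open>r \<noteq> 0\<close> show False by simp
  qed
  \<comment> \<open>Pseudo-division only yields that \<open>R\<close> divides
    \<open>smult c P\<close>. Passing to primitive parts, which are multiplicative by Gauss's lemma,
    strips the constant \<open>c\<close>; \<open>R\<close> is unchanged because its content is
    1.\<close>
  then have "smult (unit_factor c) (primitive_part P) = R * primitive_part q"
    using arg_cong[OF eq, of primitive_part] cR
    by (simp add: primitive_part_mult primitive_part_smult primitive_part_prim)
  then have "R dvd smult (unit_factor c) (primitive_part P)" by simp
  then have "R dvd primitive_part P"
    using c0 by (simp add: dvd_smult_iff sgn_if split: if_splits)
  then show ?thesis by (metis content_times_primitive_part dvd_smult)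
qed

lemma is_minimal_poly_minimal_poly:
  assumes "common_root_poly \<alpha> P" "P \<noteq> 0"
  shows "is_minimal_poly \<alpha> (minimal_poly \<alpha>)"
proof -
  have "content (primitive_part P) = 1 \<and> common_root_poly \<alpha> (primitive_part P)"
    using assms common_root_poly_primitive_part by simp
  from ex_has_least_nat[of "\<lambda>R. content R = 1 \<and> common_root_poly \<alpha> R", OF this, of degree]
  have "\<exists>R. is_minimal_poly \<alpha> R" by (auto simp: is_minimal_poly_def)
  then show ?thesis unfolding minimal_poly_def by (rule someI_ex)
qed

lemma degree_pos_if_root:
  assumes "common_root_poly \<alpha> P" "P \<noteq> 0"
  shows "degree P > 0"
proof (rule ccontr)
  assume "\<not> degree P > 0"
  then obtain c where "P = [:c:]" by (metis degree_eq_zeroE neq0_conv)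
  with assms show False by (simp add: common_root_poly_def map_poly_pCons)
qed

text \<open>The minimal polynomial divides \<open>P\<close> and is not constant, so the cofactor is
  a unit of Z[t], that is 1 or -1. This ties the \<open>SOME\<close> in \<open>minimal_poly\<close>
  to any irreducible polynomial at hand, both for membership in \<open>algebraic_points\<close> and
  for recovering a polynomial from a point.\<close>

lemma irreducible_eq_minimal_poly:
  assumes irr: "irreducible P" and P: "common_root_poly \<alpha> P"
  shows "minimal_poly \<alpha> = P \<or> minimal_poly \<alpha> = - P"
proof -
  let ?R = "minimal_poly \<alpha>"
  have P0: "P \<noteq> 0" using irr by auto
  have R: "is_minimal_poly \<alpha> ?R" using is_minimal_poly_minimal_poly[OF P P0] .
  then have dR: "degree ?R > 0" by (intro degree_pos_if_root) (auto simp: is_minimal_poly_def)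
  obtain k where k: "P = ?R * k" using is_minimal_poly_dvd[OF R P] by (elim dvdE)
  have "\<not> is_unit ?R" using dR by (auto simp: is_unit_poly_iff)
  with irreducibleD[OF irr k] have "is_unit k" by blast
  then obtain c where "k = [:c:]" "is_unit c" by (auto simp: is_unit_poly_iff)
  then have "k = [:1:] \<or> k = [:-1:]" by (auto simp: zdvd1_eq abs_if split: if_splits)
  then have "P = ?R \<or> P = - ?R" by (subst (1 2) k) auto
  then show ?thesis by auto
qed

section \<open>Heights and membership in \<open>algebraic_points\<close>\<close>

lemma poly_height_minus: "poly_height (- P) = poly_height P"
  by (simp add: poly_height_def)

lemma poly_height_le_iff: "poly_height P \<le> h \<longleftrightarrow> (\<forall>j\<le>degree P. \<bar>coeff P j\<bar> \<le> h)"
  by (auto simp: poly_height_def)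

lemma abs_coeff_le_poly_height: "\<bar>coeff P j\<bar> \<le> poly_height P"
proof (cases "j \<le> degree P")
  case True
  then show ?thesis using poly_height_le_iff[of P "poly_height P"] by simp
next
  case False
  have "0 \<le> \<bar>coeff P 0\<bar>" by simp
  also have "\<dots> \<le> poly_height P" using poly_height_le_iff[of P "poly_height P"] by simp
  finally show ?thesis using False by (simp add: coeff_eq_0)
qed

lemma algebraic_points_minimal_polyD:
  assumes "\<alpha> \<in> algebraic_points n Q"
  shows "minimal_poly \<alpha> \<noteq> 0" "degree (minimal_poly \<alpha>) \<le> n"
    "\<bar>real_of_int (coeff (minimal_poly \<alpha>) j)\<bar> \<le> Q"
    "common_root_poly \<alpha> (minimal_poly \<alpha>)" "fst \<alpha> \<noteq> snd \<alpha>"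
proof -
  obtain P where "irreducible P" "common_root_poly \<alpha> P" and ne: "fst \<alpha> \<noteq> snd \<alpha>"
    using assms by (auto simp: algebraic_points_def algebraic_point_def)
  then have "is_minimal_poly \<alpha> (minimal_poly \<alpha>)"
    by (intro is_minimal_poly_minimal_poly) auto
  then show "minimal_poly \<alpha> \<noteq> 0" "common_root_poly \<alpha> (minimal_poly \<alpha>)" "fst \<alpha> \<noteq> snd \<alpha>"
    using ne by (auto simp: is_minimal_poly_def)
  show "degree (minimal_poly \<alpha>) \<le> n"
    using assms by (simp add: algebraic_points_def point_degree_def)
  have "real_of_int \<bar>coeff (minimal_poly \<alpha>) j\<bar> \<le> real_of_int (point_height \<alpha>)"
    using abs_coeff_le_poly_height[of "minimal_poly \<alpha>" j] unfolding point_height_def by linarith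
  then show "\<bar>real_of_int (coeff (minimal_poly \<alpha>) j)\<bar> \<le> Q"
    using assms by (simp add: algebraic_points_def)
qed

lemma algebraic_pointsI:
  assumes "irreducible P" "common_root_poly \<alpha> P" "fst \<alpha> \<noteq> snd \<alpha>" "degree P \<le> n"
    and "\<And>j. j \<le> n \<Longrightarrow> \<bar>real_of_int (coeff P j)\<bar> \<le> Q"
  shows "\<alpha> \<in> algebraic_points n Q"
proof -
  have "poly_height P \<le> \<lfloor>Q\<rfloor>"
    unfolding poly_height_le_iff using assms(4,5) by (auto simp: le_floor_iff)
  then have "real_of_int (poly_height P) \<le> Q" by linarith
  then show ?thesis
    using assms irreducible_eq_minimal_poly[OF assms(1,2)]
    by (auto simp: algebraic_points_def algebraic_point_def point_degree_def point_height_def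
        poly_height_minus)
qed

section \<open>Eisenstein's criterion\<close>

text \<open>Let \<open>i\<close> be the first index at which \<open>p\<close> does not divide the
  coefficient of \<open>F\<close>. Modulo \<open>p\<close> the coefficient of \<open>F * G\<close>
  at \<open>i\<close> is \<open>coeff F i * coeff G 0\<close>, which is nonzero, so \<open>i\<close>
  is at least the degree of the product. Since \<open>i\<close> is at most \<open>degree F\<close>,
  no degree is left for \<open>G\<close>.\<close>

lemma Eisenstein_degree:
  fixes F G :: "'a::{idom,algebraic_semidom} poly"
  assumes p: "prime_elem p"
    and lead: "\<not> p dvd lead_coeff (F * G)"
    and low: "\<And>i. i < degree (F * G) \<Longrightarrow> p dvd coeff (F * G) i"
    and G0: "\<not> p dvd coeff G 0"
  shows "degree G = 0 \<or> \<not> p dvd coeff F 0"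
proof (rule disjCI)
  have ne: "F \<noteq> 0" "G \<noteq> 0" using lead by auto
  have "\<not> p dvd lead_coeff F" using lead by (auto simp: lead_coeff_mult)
  define i where "i = (LEAST i. \<not> p dvd coeff F i)"
  have i: "\<not> p dvd coeff F i" unfolding i_def by (rule LeastI) fact
  have less: "p dvd coeff F j" if "j < i" for j using not_less_Least that unfolding i_def by blast
  have "i \<le> degree F" unfolding i_def by (rule Least_le) fact
  have "coeff (F * G) i = (\<Sum>j<i. coeff F j * coeff G (i - j)) + coeff F i * coeff G 0"
    unfolding coeff_mult lessThan_Suc_atMost[symmetric] by simp
  moreover have "p dvd (\<Sum>j<i. coeff F j * coeff G (i - j))" by (intro dvd_sum) (simp add: less)
  moreover have "\<not> p dvd coeff F i * coeff G 0" using i G0 p by (simp add: prime_elem_dvd_mult_iff)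
  ultimately have "\<not> p dvd coeff (F * G) i" by (simp add: dvd_add_right_iff)
  then have "\<not> i < degree (F * G)" using low by blast
  then show "degree G = 0" using \<open>i \<le> degree F\<close> ne by (simp add: degree_mult_eq)
qed

text \<open>The constant term is divisible by \<open>p\<close> but not by its square, so exactly one
  factor has a constant term divisible by \<open>p\<close>; \<open>Eisenstein_degree\<close> then
  makes the other factor constant.\<close>

lemma Eisenstein_irreducible:
  fixes P :: "int poly"
  assumes p: "prime p" and deg: "degree P > 0" and cont: "content P = 1"
    and lead: "\<not> p dvd lead_coeff P"
    and low: "\<And>i. i < degree P \<Longrightarrow> p dvd coeff P i"
    and sq: "\<not> p\<^sup>2 dvd coeff P 0"
  shows "irreducible P"
proof (rule irreducibleI)
  have pe: "prime_elem p" using p by (rule prime_imp_prime_elem)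
  \<comment> \<open>Irreducibility is meant in Z[t], where a constant factor need not be a unit;
    content 1 is what forces it to be one.\<close>
  have unit: "is_unit G" if FG: "P = F * G" and dG: "degree G = 0" for F G
  proof -
    obtain c where c: "G = [:c:]" using degree_eq_zeroE[OF dG] by blast
    have "content G dvd content P" unfolding FG by (intro content_dvd_contentI dvd_triv_right)
    then have "content G = 1" unfolding cont is_unit_content_iff .
    then have "is_unit c" using c by simp
    then show ?thesis unfolding c is_unit_const_poly_iff .
  qed
  have main: "is_unit G" if "P = F * G" "p dvd coeff F 0" for F G
  proof (rule unit)
    have "coeff P 0 = coeff F 0 * coeff G 0" unfolding that(1) by (simp add: coeff_mult)
    then have "\<not> p dvd coeff G 0" using that(2) sq mult_dvd_mono[of p "coeff F 0" p "coeff G 0"]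
      by (auto simp: power2_eq_square)
    from Eisenstein_degree[OF pe lead[unfolded that(1)] low[unfolded that(1)] this] that(2)
    show "degree G = 0" by simp
  qed fact
  show "P \<noteq> 0" using deg by auto
  show "\<not> is_unit P" using deg by (auto simp: is_unit_poly_iff)
  fix F G assume FG: "P = F * G"
  have "p dvd coeff F 0 * coeff G 0" using low[OF deg] unfolding FG by (simp add: coeff_mult)
  then have "p dvd coeff F 0 \<or> p dvd coeff G 0" using p by (simp add: prime_dvd_mult_iff)
  moreover have "P = G * F" using FG by (simp only: mult.commute)
  ultimately show "is_unit F \<or> is_unit G" using main[OF FG] main[of G F] by blast
qed

section \<open>Coprime pairs in a window\<close>

text \<open>All elements of \<open>S\<close> leave the same remainder after shifting by
  \<open>p\<close>, so they are told apart by their quotients by \<open>q\<close>, which range over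
  \<open>{0..int N div q}\<close>.\<close>

lemma card_congruent_le:
  fixes p q :: int
  assumes q: "q > 0" and S: "S \<subseteq> {p..<p + int N}"
    and cong: "\<And>u v. u \<in> S \<Longrightarrow> v \<in> S \<Longrightarrow> q dvd u - v"
  shows "real (card S) \<le> real N / real_of_int q + 1"
proof -
  have "inj_on (\<lambda>u. (u - p) div q) S"
  proof
    fix u v assume uv: "u \<in> S" "v \<in> S" "(u - p) div q = (v - p) div q"
    have "q dvd (u - p) - (v - p)" using cong[OF uv(1,2)] by simp
    then have "(u - p) mod q = (v - p) mod q" by (simp add: mod_eq_dvd_iff)
    then show "u = v" using uv(3) by (metis diff_add_cancel mult_div_mod_eq)
  qed
  moreover have "(\<lambda>u. (u - p) div q) ` S \<subseteq> {0..int N div q}"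
    using S q by (force intro!: zdiv_mono1 simp: pos_imp_zdiv_nonneg_iff)
  ultimately have "card S \<le> card {0..int N div q}" by (intro card_inj_on_le) auto
  then have "real (card S) \<le> real (nat (int N div q + 1))" by simp
  also have "\<dots> = real_of_int (int N div q) + 1" using q by (simp add: pos_imp_zdiv_nonneg_iff)
  also have "\<dots> \<le> real N / real_of_int q + 1"
    using real_of_int_div4[of "int N" q] by simp
  finally show ?thesis .
qed

text \<open>Writing \<open>q = 2 * i + 3\<close> gives q^2 = 4 (i + 1) (i + 2) + 1, so 1 / q^2 is
  below the telescoping term 1 / (4 (i + 1)) - 1 / (4 (i + 2)), whose full sum is 1 / 4.\<close>

lemma sum_inverse_squares_odd_le:
  fixes S :: "int set"
  assumes "finite S" "\<And>q. q \<in> S \<Longrightarrow> odd q \<and> q \<ge> 3"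
  shows "(\<Sum>q\<in>S. 1 / (real_of_int q)\<^sup>2) \<le> 1 / 4"
proof -
  let ?k = "\<lambda>q::int. nat ((q - 3) div 2)"
  let ?t = "\<lambda>i::nat. 1 / (4 * (real i + 1)) - 1 / (4 * (real (Suc i) + 1))"
  have rep: "q = 2 * int (?k q) + 3" if "q \<in> S" for q using assms(2)[OF that] by (auto elim!: oddE)
  have inj: "inj_on ?k S"
  proof
    fix x y assume xy: "x \<in> S" "y \<in> S" "?k x = ?k y"
    show "x = y" using rep[OF xy(1)] rep[OF xy(2)] unfolding xy(3) by (rule trans[OF _ sym])
  qed
  obtain K where K: "?k ` S \<subseteq> {..<K}" using assms(1) finite_nat_iff_bounded[of "?k ` S"] by auto
  have le: "1 / (real_of_int q)\<^sup>2 \<le> ?t (?k q)" if "q \<in> S" for q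
  proof -
    define i where "i = ?k q"
    have "real_of_int q = 2 * real i + 3" using rep[OF that] unfolding i_def by linarith
    then have "1 / (real_of_int q)\<^sup>2 = 1 / (4 * (real i + 1) * (real i + 2) + 1)"
      by (simp add: power2_eq_square algebra_simps)
    also have "\<dots> \<le> 1 / (4 * (real i + 1) * (real i + 2))"
      by (intro divide_left_mono) (auto intro!: mult_pos_pos add_pos_pos simp: add_nonneg_pos)
    also have "\<dots> = ?t i" by (simp add: divide_simps)
    finally show ?thesis unfolding i_def .
  qed
  have "(\<Sum>q\<in>S. 1 / (real_of_int q)\<^sup>2) \<le> (\<Sum>q\<in>S. ?t (?k q))" by (intro sum_mono le)
  also have "\<dots> = (\<Sum>i\<in>?k ` S. ?t i)" using inj by (simp add: sum.reindex)
  also have "\<dots> \<le> (\<Sum>i<K. ?t i)"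
    by (intro sum_mono2 K) (auto intro!: divide_left_mono)
  also have "\<dots> = 1 / 4 - 1 / (4 * (real K + 1))"
    by (subst sum_lessThan_telescope') simp
  also have "\<dots> \<le> 1 / 4" by simp
  finally show ?thesis .
qed

lemma two_power_card_prime_factors_le:
  assumes "A > (0::int)"
  shows "2 ^ card (prime_factors A) \<le> A"
proof -
  have "2 ^ card (prime_factors A) = (\<Prod>p\<in>prime_factors A. (2::int))" by simp
  also have "\<dots> \<le> (\<Prod>p\<in>prime_factors A. p ^ multiplicity p A)"
  proof (intro prod_mono conjI)
    fix p assume p: "p \<in> prime_factors A"
    then have "prime p" "multiplicity p A > 0" by (auto simp: prime_factors_multiplicity)
    then have "p \<le> p ^ multiplicity p A" "2 \<le> p"
      by (auto intro!: self_le_power simp: prime_ge_1_int prime_ge_2_int)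
    then show "2 \<le> p ^ multiplicity p A" by simp
  qed auto
  also have "\<dots> = A" using assms by (simp add: prod_prime_factors)
  finally show ?thesis .
qed

text \<open>A union bound over the primes \<open>q\<close> dividing \<open>A\<close>. Each excludes
  at most (N/q + 1)^2, hence at most 2 N^2/q^2 + 2, of the N^2 pairs. Summing, the first terms cost
  at most N^2/2 and the second at most 2 log A (base 2), which is at most N^2/4. The forms
  \<open>2 * v\<close> and \<open>4 * u + 2\<close> are those of the linear and constant
  coefficients of the Eisenstein polynomials built later, with \<open>A\<close> as leading
  coefficient.\<close>

lemma card_jointly_coprime_pairs_ge:
  fixes A p r :: int
  assumes A: "A > 0" "odd A" and N: "8 * log 2 (real_of_int A) \<le> (real N)\<^sup>2"
  shows "(real N)\<^sup>2 / 4 \<le> real (card {(v, u) \<in> {p..<p + int N} \<times> {r..<r + int N}.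
           \<forall>q. prime q \<and> q dvd A \<longrightarrow> \<not> (q dvd 2 * v \<and> q dvd 4 * u + 2)})"
    (is "_ \<le> real (card ?G)")
proof -
  let ?I = "{p..<p + int N}" and ?J = "{r..<r + int N}" and ?P = "prime_factors A"
  let ?V = "\<lambda>q. {v \<in> ?I. q dvd 2 * v}" and ?U = "\<lambda>q. {u \<in> ?J. q dvd 4 * u + 2}"
  have fin: "finite (?V q)" "finite (?U q)" for q
    by (rule finite_subset[of _ ?I], auto) (rule finite_subset[of _ ?J], auto)
  have odd: "odd q \<and> q \<ge> 3 \<and> prime q" if "q \<in> ?P" for q
  proof -
    have q: "prime q" "q dvd A" using that by auto
    then have "odd q" using A by (metis dvd_trans)
    moreover have "q \<ge> 2" using q by (simp add: prime_ge_2_int)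
    ultimately show ?thesis using q by (cases "q = 2") auto
  qed
  have card_le: "real (card (?V q)) \<le> real N / q + 1" "real (card (?U q)) \<le> real N / q + 1"
    if q: "q \<in> ?P" for q
  proof -
    have cop: "coprime q (2::int)" "coprime q (4::int)"
      using odd[OF q] coprime_power_right_iff[of q 2 2] by auto
    show "real (card (?V q)) \<le> real N / q + 1"
      using odd[OF q] cop by (intro card_congruent_le) (auto simp: coprime_dvd_mult_right_iff)
    have "q dvd u - v" if "q dvd 4 * u + 2" "q dvd 4 * v + 2" for u v :: int
    proof -
      have "q dvd (4 * u + 2) - (4 * v + 2)" using that by (rule dvd_diff)
      then have "q dvd 4 * (u - v)" by (simp add: algebra_simps)
      then show ?thesis by (simp only: coprime_dvd_mult_right_iff[OF cop(2)])
    qed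
    then show "real (card (?U q)) \<le> real N / q + 1"
      using odd[OF q] by (intro card_congruent_le) auto
  qed
  have sub: "?I \<times> ?J \<subseteq> ?G \<union> (\<Union>q\<in>?P. ?V q \<times> ?U q)"
    using A by (auto simp: prime_factors_dvd)
  have finG: "finite ?G" by (rule finite_subset[of _ "?I \<times> ?J"]) auto
  have "N * N = card (?I \<times> ?J)" by (simp add: card_cartesian_product)
  also have "\<dots> \<le> card (?G \<union> (\<Union>q\<in>?P. ?V q \<times> ?U q))"
    using finG fin by (intro card_mono sub) auto
  also have "\<dots> \<le> card ?G + card (\<Union>q\<in>?P. ?V q \<times> ?U q)" by (rule card_Un_le)
  also have "card (\<Union>q\<in>?P. ?V q \<times> ?U q) \<le> (\<Sum>q\<in>?P. card (?V q \<times> ?U q))"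
    by (intro card_UN_le) simp
  finally have "real (N * N) \<le> real (card ?G) + (\<Sum>q\<in>?P. real (card (?V q)) * real (card (?U q)))"
    by (simp add: card_cartesian_product flip: of_nat_mult of_nat_sum of_nat_add)
  also have "(\<Sum>q\<in>?P. real (card (?V q)) * real (card (?U q)))
      \<le> (\<Sum>q\<in>?P. 2 * (real N)\<^sup>2 * (1 / (real_of_int q)\<^sup>2) + 2)"
  proof (rule sum_mono)
    fix q assume q: "q \<in> ?P"
    have "real (card (?V q)) * real (card (?U q)) \<le> (real N / q + 1) * (real N / q + 1)"
      using card_le[OF q] odd[OF q] by (intro mult_mono) auto
    also have "\<dots> \<le> 2 * (real N / q)\<^sup>2 + 2"
    proof -
      have "(t + 1) * (t + 1) \<le> 2 * t\<^sup>2 + 2" for t :: real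
        using zero_le_power2[of "t - 1"] by (simp add: power2_eq_square algebra_simps)
      then show ?thesis .
    qed
    finally show "real (card (?V q)) * real (card (?U q))
        \<le> 2 * (real N)\<^sup>2 * (1 / (real_of_int q)\<^sup>2) + 2" by (simp add: power_divide)
  qed
  also have "\<dots> = 2 * (real N)\<^sup>2 * (\<Sum>q\<in>?P. 1 / (real_of_int q)\<^sup>2) + 2 * real (card ?P)"
    by (simp add: sum.distrib sum_distrib_left)
  also have "(\<Sum>q\<in>?P. 1 / (real_of_int q)\<^sup>2) \<le> 1 / 4"
    using odd by (intro sum_inverse_squares_odd_le) auto
  also have "real (card ?P) \<le> log 2 (real_of_int A)"
  proof -
    have "real_of_int (2 ^ card ?P) \<le> real_of_int A"
      using two_power_card_prime_factors_le[OF A(1)] by (simp only: of_int_le_iff)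
    then show ?thesis using A by (simp add: le_log_iff powr_realpow)
  qed
  finally have "real (N * N) \<le> real (card ?G) + (2 * (real N)\<^sup>2 * (1 / 4) + 2 * log 2 (real_of_int A))"
    by (simp add: mult_left_mono)
  then show ?thesis using N by (simp add: power2_eq_square)
qed

section \<open>Divided differences and the upper bound\<close>

text \<open>The divided difference of \<open>t\<^sup>j\<close> at \<open>x\<close> and \<open>y\<close>, in a form that also makes sense for \<open>x = y\<close>.\<close>

primrec divdiff :: "nat \<Rightarrow> 'a::comm_ring_1 \<Rightarrow> 'a \<Rightarrow> 'a" where
  "divdiff 0 x y = 0"
| "divdiff (Suc j) x y = x ^ j + y * divdiff j x y"

lemma divdiff_mult: "(x - y) * divdiff j x y = x ^ j - y ^ j"
proof (induction j)
  case (Suc j)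
  have "(x - y) * divdiff (Suc j) x y = (x - y) * x ^ j + y * ((x - y) * divdiff j x y)"
    by (simp add: algebra_simps)
  then show ?case by (simp add: Suc) (simp add: algebra_simps)
qed simp

lemma divdiff_of_real:
  "divdiff j (complex_of_real x) (complex_of_real y) = complex_of_real (divdiff j x y)"
  by (induction j) auto

lemma norm_divdiff_le:
  fixes x y :: "'a::real_normed_field"
  assumes "norm x \<le> B" "norm y \<le> B" "1 \<le> B"
  shows "norm (divdiff j x y) \<le> real j * B ^ j"
proof (induction j)
  case (Suc j)
  have "norm (divdiff (Suc j) x y) \<le> norm x ^ j + norm y * norm (divdiff j x y)"
    unfolding divdiff.simps norm_mult[symmetric] norm_power[symmetric] by (rule norm_triangle_ineq)
  also have "\<dots> \<le> B ^ j + B * (real j * B ^ j)"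
    using assms Suc by (intro add_mono mult_mono power_mono) auto
  also have "\<dots> \<le> B * B ^ j + B * (real j * B ^ j)"
    using assms(3) by simp
  finally show ?case by (simp add: algebra_simps)
qed simp

lemma norm_power_diff_le:
  fixes x x' :: "'a::real_normed_field"
  assumes "norm x \<le> B" "norm x' \<le> B" "1 \<le> B" "norm (x - x') \<le> s"
  shows "norm (x ^ j - x' ^ j) \<le> real j * B ^ j * s"
proof -
  have "norm (x ^ j - x' ^ j) = norm (x - x') * norm (divdiff j x x')"
    by (simp flip: divdiff_mult add: norm_mult)
  also have "\<dots> \<le> s * (real j * B ^ j)"
    using assms norm_divdiff_le[OF assms(1-3), of j] order_trans[OF norm_ge_zero assms(4)]
    by (intro mult_mono) auto
  finally show ?thesis by (simp add: mult_ac)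
qed

text \<open>The estimate follows the recursion of \<open>divdiff\<close> and never divides by
  \<open>x - y\<close>, so it stays uniform when the two points approach each other.\<close>

lemma norm_divdiff_diff_le:
  fixes x x' y y' :: "'a::real_normed_field"
  assumes "norm x \<le> B" "norm x' \<le> B" "norm y \<le> B" "norm y' \<le> B" "1 \<le> B"
    and s: "norm (x - x') \<le> s" "norm (y - y') \<le> s"
  shows "norm (divdiff j x y - divdiff j x' y') \<le> (real j)\<^sup>2 * B ^ j * s"
proof (induction j)
  case (Suc j)
  have s0: "0 \<le> s" using order_trans[OF norm_ge_zero s(1)] .
  have "divdiff (Suc j) x y - divdiff (Suc j) x' y' = (x ^ j - x' ^ j)
      + (y * (divdiff j x y - divdiff j x' y') + (y - y') * divdiff j x' y')"
    by (simp add: algebra_simps)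
  then have "norm (divdiff (Suc j) x y - divdiff (Suc j) x' y') \<le> norm (x ^ j - x' ^ j)
      + (norm y * norm (divdiff j x y - divdiff j x' y') + norm (y - y') * norm (divdiff j x' y'))"
    by (simp only: norm_mult[symmetric]) (rule norm_triangle_le[OF add_left_mono[OF norm_triangle_ineq]])
  also have "\<dots> \<le> real j * B ^ j * s + (B * ((real j)\<^sup>2 * B ^ j * s) + s * (real j * B ^ j))"
    using assms s0 Suc norm_divdiff_le[OF assms(2,4,5), of j]
    by (intro add_mono mult_mono norm_power_diff_le) auto
  also have "\<dots> = (2 * real j) * (B ^ j * s) + (real j)\<^sup>2 * (B * B ^ j * s)"
    by (simp add: algebra_simps)
  also have "\<dots> \<le> (2 * real j) * (B * B ^ j * s) + (real j)\<^sup>2 * (B * B ^ j * s)"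
    using assms(5) s0 by (intro add_right_mono mult_left_mono mult_right_mono) auto
  also have "\<dots> \<le> (real (Suc j))\<^sup>2 * B ^ Suc j * s"
  proof -
    have "0 \<le> B * B ^ j * s" using assms(5) s0 by simp
    then show ?thesis by (simp add: power2_eq_square algebra_simps)
  qed
  finally show ?case .
qed simp

section \<open>Counting polynomials and algebraic points near a given pair\<close>

lemma card_Sigma_le:
  assumes "finite A" "\<And>x. x \<in> A \<Longrightarrow> finite (F x)" "\<And>x. x \<in> A \<Longrightarrow> real (card (F x)) \<le> c"
  shows "real (card (Sigma A F)) \<le> real (card A) * c"
proof -
  have "real (card (Sigma A F)) = (\<Sum>x\<in>A. real (card (F x)))"
    using assms by (subst card_SigmaI) auto
  also have "\<dots> \<le> real (card A) * c" using assms by (intro sum_bounded_above) auto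
  finally show ?thesis .
qed

lemma card_ints_near_le:
  fixes t E :: real
  assumes "E \<ge> 0"
  shows "finite {k::int. \<bar>real_of_int k + t\<bar> \<le> E}"
    and "real (card {k::int. \<bar>real_of_int k + t\<bar> \<le> E}) \<le> 2 * E + 1"
proof -
  have eq: "{k::int. \<bar>real_of_int k + t\<bar> \<le> E} = {\<lceil>- E - t\<rceil>..\<lfloor>E - t\<rfloor>}"
    by (auto simp: ceiling_le_iff le_floor_iff abs_le_iff)
  show "finite {k::int. \<bar>real_of_int k + t\<bar> \<le> E}" unfolding eq by simp
  show "real (card {k::int. \<bar>real_of_int k + t\<bar> \<le> E}) \<le> 2 * E + 1"
    unfolding eq using assms by simp linarith
qed

text \<open>\<open>E\<close> bounds both the value at \<open>x\<close> and the divided difference at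
  \<open>x\<close>, \<open>y\<close>: each of the n + 1 terms moves by at most
  \<open>Q * ((real n)\<^sup>2 * B ^ n * \<rho>)\<close> from the exact roots. A polynomial is
  encoded by its coefficients from degree 2 on, then the linear one, then the constant one; the last
  two have at most \<open>2 * E + 1\<close> choices each.\<close>

lemma card_int_polys_roots_near_le:
  fixes x y B Q \<rho> :: real
  assumes n: "n \<ge> 1" and Q: "Q \<ge> 1" and B: "\<bar>x\<bar> + \<rho> \<le> B" "\<bar>y\<bar> + \<rho> \<le> B" "1 \<le> B" and \<rho>: "\<rho> \<ge> 0"
  defines "E \<equiv> (real n + 1) * (real n)\<^sup>2 * B ^ n * Q * \<rho>"
  defines "S \<equiv> {P :: int poly. degree P \<le> n \<and> (\<forall>j. \<bar>real_of_int (coeff P j)\<bar> \<le> Q) \<and>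
    (\<exists>\<alpha>. fst \<alpha> \<noteq> snd \<alpha> \<and> common_root_poly \<alpha> P \<and> cmod (fst \<alpha> - of_real x) \<le> \<rho> \<and> cmod (snd \<alpha> - of_real y) \<le> \<rho>)}"
  shows "finite S" "real (card S) \<le> (3 * Q) ^ (n - 1) * (2 * E + 1)\<^sup>2"
proof -
  have E0: "E \<ge> 0" unfolding E_def using Q B \<rho> by simp
  define X where "X = complex_of_real x" define Y where "Y = complex_of_real y"
  have near: "\<bar>\<Sum>j\<le>n. real_of_int (coeff P j) * x ^ j\<bar> \<le> E \<and>
      \<bar>\<Sum>j\<le>n. real_of_int (coeff P j) * divdiff j x y\<bar> \<le> E" if PS: "P \<in> S" for P
  proof -
    from PS obtain \<alpha> where deg: "degree P \<le> n" and co: "\<And>j. \<bar>real_of_int (coeff P j)\<bar> \<le> Q"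
      and ne: "fst \<alpha> \<noteq> snd \<alpha>" and rt: "common_root_poly \<alpha> P"
      and nr: "cmod (fst \<alpha> - of_real x) \<le> \<rho>" "cmod (snd \<alpha> - of_real y) \<le> \<rho>"
      unfolding S_def by blast
    define u where "u = fst \<alpha>" define v where "v = snd \<alpha>"
    have nX: "cmod (X - u) \<le> \<rho>" "cmod (Y - v) \<le> \<rho>"
      using nr unfolding X_def Y_def u_def v_def by (simp_all add: norm_minus_commute)
    have bX: "cmod X \<le> B" "cmod Y \<le> B" unfolding X_def Y_def using B \<rho> by auto
    have "cmod u \<le> cmod X + cmod (X - u)" "cmod v \<le> cmod Y + cmod (Y - v)"
      by (metis norm_minus_commute norm_triangle_sub)+
    then have bu: "cmod u \<le> B" "cmod v \<le> B" using nX B unfolding X_def Y_def by auto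
    have pu: "(\<Sum>j\<le>n. of_int (coeff P j) * u ^ j) = 0" and pv: "(\<Sum>j\<le>n. of_int (coeff P j) * v ^ j) = 0"
      using rt deg unfolding common_root_poly_def u_def v_def by (auto simp: poly_map_of_int_sum)
    \<comment> \<open>The divided difference of \<open>P\<close> at two distinct roots vanishes
      exactly.\<close>
    have "(u - v) * (\<Sum>j\<le>n. of_int (coeff P j) * divdiff j u v)
        = (\<Sum>j\<le>n. of_int (coeff P j) * ((u - v) * divdiff j u v))"
      by (simp add: sum_distrib_left mult_ac)
    also have "\<dots> = 0" by (simp add: divdiff_mult right_diff_distrib sum_subtractf pu pv)
    finally have pd: "(\<Sum>j\<le>n. of_int (coeff P j) * divdiff j u v) = 0"
      using ne unfolding u_def v_def by simp
    \<comment> \<open>One perturbation estimate serves both quantities: \<open>f\<close> is the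
      family at the exact roots, where the sum is zero, and \<open>g\<close> the family at the
      centres.\<close>
    have bound: "cmod (\<Sum>j\<le>n. of_int (coeff P j) * g j) \<le> E"
      if z: "(\<Sum>j\<le>n. of_int (coeff P j) * f j) = 0"
        and fg: "\<And>j. j \<le> n \<Longrightarrow> cmod (g j - f j) \<le> (real j)\<^sup>2 * B ^ j * \<rho>" for f g :: "nat \<Rightarrow> complex"
    proof -
      have "cmod (\<Sum>j\<le>n. of_int (coeff P j) * g j) = cmod (\<Sum>j\<le>n. of_int (coeff P j) * (g j - f j))"
        using z by (simp add: right_diff_distrib sum_subtractf)
      also have "\<dots> \<le> of_nat (card {..n}) * (Q * ((real n)\<^sup>2 * B ^ n * \<rho>))"
      proof (rule sum_norm_bound)
        fix j assume "j \<in> {..n}"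
        then have j: "j \<le> n" by simp
        have "(real j)\<^sup>2 * B ^ j * \<rho> \<le> (real n)\<^sup>2 * B ^ n * \<rho>"
          using j B(3) \<rho> by (intro mult_right_mono mult_mono power_mono power_increasing) auto
        with fg[OF j] have "cmod (g j - f j) \<le> (real n)\<^sup>2 * B ^ n * \<rho>" by simp
        then show "cmod (of_int (coeff P j) * (g j - f j)) \<le> Q * ((real n)\<^sup>2 * B ^ n * \<rho>)"
          unfolding norm_mult using co[of j] Q by (intro mult_mono) auto
      qed
      finally show ?thesis by (simp add: E_def algebra_simps)
    qed
    have "cmod (\<Sum>j\<le>n. of_int (coeff P j) * X ^ j) \<le> E"
    proof (rule bound[OF pu])
      fix j :: nat
      have "cmod (X ^ j - u ^ j) \<le> real j * B ^ j * \<rho>"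
        using bX bu B nX by (intro norm_power_diff_le) auto
      also have "\<dots> \<le> (real j)\<^sup>2 * B ^ j * \<rho>"
        using B \<rho> by (intro mult_right_mono) (cases j, auto simp: power2_eq_square)
      finally show "cmod (X ^ j - u ^ j) \<le> (real j)\<^sup>2 * B ^ j * \<rho>" .
    qed
    moreover have "(\<Sum>j\<le>n. of_int (coeff P j) * X ^ j) = of_real (\<Sum>j\<le>n. real_of_int (coeff P j) * x ^ j)"
      by (simp add: X_def)
    moreover have "cmod (\<Sum>j\<le>n. of_int (coeff P j) * divdiff j X Y) \<le> E"
      using bX bu B nX by (intro bound[OF pd] norm_divdiff_diff_le) auto
    moreover have "(\<Sum>j\<le>n. of_int (coeff P j) * divdiff j X Y)
        = of_real (\<Sum>j\<le>n. real_of_int (coeff P j) * divdiff j x y)"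
      by (simp add: X_def Y_def divdiff_of_real)
    ultimately show ?thesis by (simp only: norm_of_real)
  qed
  define F where "F = ({2..n} \<rightarrow>\<^sub>E {- \<lfloor>Q\<rfloor>..\<lfloor>Q\<rfloor>} :: (nat \<Rightarrow> int) set)"
  define I where "I = (\<lambda>t. {k::int. \<bar>real_of_int k + t\<bar> \<le> E})"
  define p where "p = (\<lambda>f::nat \<Rightarrow> int. \<Sum>j\<in>{2..n}. real_of_int (f j) * divdiff j x y)"
  define r where "r = (\<lambda>f::nat \<Rightarrow> int. \<Sum>j\<in>{2..n}. real_of_int (f j) * x ^ j)"
  \<comment> \<open>Since \<open>divdiff 0 x y = 0\<close> and \<open>divdiff 1 x y = 1\<close>, the
    divided difference involves the linear coefficient \<open>k\<close> with factor 1 and not the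
    constant one. So \<open>k\<close> is confined first, and the value at \<open>x\<close> then
    confines the constant coefficient.\<close>
  define T where "T = (SIGMA f:F. SIGMA k:I (p f). I (real_of_int k * x + r f))"
  define \<Phi> where "\<Phi> = (\<lambda>P::int poly. (restrict (coeff P) {2..n}, coeff P 1, coeff P 0))"
  have finI: "finite (I t)" and cardI: "real (card (I t)) \<le> 2 * E + 1" for t
    unfolding I_def using card_ints_near_le[OF E0] by auto
  have finF: "finite F" unfolding F_def by (intro finite_PiE) auto
  have finT: "finite T" unfolding T_def using finI finF by auto
  have "real (card F) = (real_of_int (2 * \<lfloor>Q\<rfloor> + 1)) ^ (n - 1)"
    using Q n by (simp add: F_def card_PiE)
  also have "\<dots> \<le> (3 * Q) ^ (n - 1)" using Q by (intro power_mono) (simp_all, linarith+)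
  finally have cardF: "real (card F) \<le> (3 * Q) ^ (n - 1)" .
  have "real (card T) \<le> real (card F) * ((2 * E + 1) * (2 * E + 1))"
    unfolding T_def
  proof (rule card_Sigma_le[OF finF])
    fix f
    show "finite (SIGMA k:I (p f). I (real_of_int k * x + r f))" using finI by auto
    have "real (card (SIGMA k:I (p f). I (real_of_int k * x + r f))) \<le> real (card (I (p f))) * (2 * E + 1)"
      using finI cardI by (intro card_Sigma_le) auto
    also have "\<dots> \<le> (2 * E + 1) * (2 * E + 1)" using cardI E0 by (intro mult_right_mono) auto
    finally show "real (card (SIGMA k:I (p f). I (real_of_int k * x + r f))) \<le> (2 * E + 1) * (2 * E + 1)" .
  qed
  also have "\<dots> \<le> (3 * Q) ^ (n - 1) * ((2 * E + 1) * (2 * E + 1))"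
    using cardF by (intro mult_right_mono) auto
  finally have cardT: "real (card T) \<le> (3 * Q) ^ (n - 1) * (2 * E + 1)\<^sup>2" by (simp add: power2_eq_square)
  have sub: "\<Phi> ` S \<subseteq> T"
  proof
    fix z assume "z \<in> \<Phi> ` S"
    then obtain P where P: "P \<in> S" and z: "z = \<Phi> P" by blast
    have split: "(\<Sum>j\<le>n. h j) = h 0 + (h 1 + (\<Sum>j\<in>{2..n}. h j))" for h :: "nat \<Rightarrow> real"
    proof -
      have "{..n} = insert 0 (insert 1 {2..n})" using n by auto
      then show ?thesis by simp
    qed
    have "\<bar>coeff P j\<bar> \<le> \<lfloor>Q\<rfloor>" for j using P by (simp add: S_def le_floor_iff)
    then have "restrict (coeff P) {2..n} \<in> F" unfolding F_def by (auto simp: abs_le_iff minus_le_iff)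
    moreover have "p (restrict (coeff P) {2..n}) = (\<Sum>j\<in>{2..n}. real_of_int (coeff P j) * divdiff j x y)"
      "r (restrict (coeff P) {2..n}) = (\<Sum>j\<in>{2..n}. real_of_int (coeff P j) * x ^ j)"
      unfolding p_def r_def by (auto intro!: sum.cong)
    ultimately show "z \<in> T"
      using near[OF P] unfolding z \<Phi>_def T_def I_def by (simp add: split add_ac)
  qed
  have inj: "inj_on \<Phi> S"
  proof
    fix P R assume PR: "P \<in> S" "R \<in> S" "\<Phi> P = \<Phi> R"
    show "P = R"
    proof (rule poly_eqI)
      fix j
      consider "j = 0" | "j = 1" | "j \<in> {2..n}" | "j > n" by fastforce
      then show "coeff P j = coeff R j"
      proof cases
        case 3
        have "restrict (coeff P) {2..n} j = restrict (coeff R) {2..n} j" using PR(3) by (simp add: \<Phi>_def)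
        with 3 show ?thesis by simp
      qed (use PR in \<open>auto simp: \<Phi>_def S_def coeff_eq_0\<close>)
    qed
  qed
  show "finite S" using finite_imageD[OF finite_subset[OF sub finT] inj] .
  have "card S \<le> card T" using card_inj_on_le[OF inj sub finT] .
  then show "real (card S) \<le> (3 * Q) ^ (n - 1) * (2 * E + 1)\<^sup>2" using cardT by linarith
qed


text \<open>Each point is a pair of roots of its minimal polynomial, and a nonzero polynomial of
  degree at most \<open>n\<close> has at most \<open>n * n\<close> such pairs. The zero polynomial
  may belong to \<open>S\<close> and is removed because its root set is infinite.\<close>

lemma card_algebraic_points_near_le:
  fixes x y B Q \<rho> :: real
  assumes n: "n \<ge> 1" and Q: "Q \<ge> 1" and B: "\<bar>x\<bar> + \<rho> \<le> B" "\<bar>y\<bar> + \<rho> \<le> B" "1 \<le> B" and \<rho>: "\<rho> \<ge> 0"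
  defines "E \<equiv> (real n + 1) * (real n)\<^sup>2 * B ^ n * Q * \<rho>"
  defines "Z \<equiv> {\<alpha> \<in> algebraic_points n Q. cmod (fst \<alpha> - of_real x) \<le> \<rho> \<and> cmod (snd \<alpha> - of_real y) \<le> \<rho>}"
  shows "finite Z" "real (card Z) \<le> (real n)\<^sup>2 * ((3 * Q) ^ (n - 1) * (2 * E + 1)\<^sup>2)"
proof -
  define S where "S = {P :: int poly. degree P \<le> n \<and> (\<forall>j. \<bar>real_of_int (coeff P j)\<bar> \<le> Q) \<and>
    (\<exists>\<alpha>. fst \<alpha> \<noteq> snd \<alpha> \<and> common_root_poly \<alpha> P \<and> cmod (fst \<alpha> - of_real x) \<le> \<rho> \<and> cmod (snd \<alpha> - of_real y) \<le> \<rho>)}"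
  have finS: "finite S" and cardS: "real (card S) \<le> (3 * Q) ^ (n - 1) * (2 * E + 1)\<^sup>2"
    unfolding S_def E_def by (rule card_int_polys_roots_near_le[OF n Q B \<rho>])+
  define R where "R = (\<lambda>P::int poly. {z::complex. poly (map_poly of_int P) z = 0})"
  have R: "finite (R P)" "card (R P) \<le> n" if "P \<in> S - {0}" for P
  proof -
    have nz: "map_poly of_int P \<noteq> (0 :: complex poly)" using that by (auto simp: poly_eq_iff coeff_map_poly)
    show "finite (R P)" unfolding R_def by (rule poly_roots_finite[OF nz])
    have "card (R P) \<le> degree (map_poly of_int P :: complex poly)"
      unfolding R_def by (rule card_poly_roots_bound[OF nz])
    also have "\<dots> \<le> degree P" by (rule degree_le) (auto simp: coeff_map_poly coeff_eq_0)
    also have "\<dots> \<le> n" using that by (simp add: S_def)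
    finally show "card (R P) \<le> n" .
  qed
  let ?U = "SIGMA P:S - {0}. R P \<times> R P"
  have finU: "finite ?U" using finS R by auto
  have "Z \<subseteq> snd ` ?U"
  proof
    fix \<alpha> assume "\<alpha> \<in> Z"
    then have \<alpha>: "\<alpha> \<in> algebraic_points n Q" "cmod (fst \<alpha> - of_real x) \<le> \<rho>" "cmod (snd \<alpha> - of_real y) \<le> \<rho>"
      by (auto simp: Z_def)
    note m = algebraic_points_minimal_polyD[OF \<alpha>(1)]
    have "minimal_poly \<alpha> \<in> S - {0}" unfolding S_def using m \<alpha>(2,3) by blast
    moreover have "\<alpha> \<in> R (minimal_poly \<alpha>) \<times> R (minimal_poly \<alpha>)"
      using m(4) by (cases \<alpha>) (simp add: R_def common_root_poly_def)
    ultimately have "(minimal_poly \<alpha>, \<alpha>) \<in> ?U" by blast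
    then show "\<alpha> \<in> snd ` ?U" by force
  qed
  then show "finite Z" using finU by (metis finite_imageI finite_subset)
  have "card Z \<le> card ?U" using surj_card_le[OF finU \<open>Z \<subseteq> snd ` ?U\<close>] .
  also have "real (card ?U) \<le> real (card (S - {0})) * (real n)\<^sup>2"
  proof (rule card_Sigma_le)
    fix P assume P: "P \<in> S - {0}"
    have "card (R P \<times> R P) \<le> n * n" using R(2)[OF P] by (simp add: card_cartesian_product mult_le_mono)
    then show "real (card (R P \<times> R P)) \<le> (real n)\<^sup>2"
      by (metis of_nat_le_iff of_nat_power power2_eq_square)
    show "finite (R P \<times> R P)" using R(1)[OF P] by auto
  qed (use finS in auto)
  also have "\<dots> \<le> (3 * Q) ^ (n - 1) * (2 * E + 1)\<^sup>2 * (real n)\<^sup>2"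
  proof (rule mult_right_mono)
    have "card (S - {0}) \<le> card S" using finS by (intro card_mono) auto
    then show "real (card (S - {0})) \<le> (3 * Q) ^ (n - 1) * (2 * E + 1)\<^sup>2" using cardS by linarith
  qed simp
  finally show "real (card Z) \<le> (real n)\<^sup>2 * ((3 * Q) ^ (n - 1) * (2 * E + 1)\<^sup>2)"
    by (simp add: mult_ac)
qed

text \<open>The points are sorted into about \<open>(b - a) / s\<close> cells by their first
  coordinate. All points of a cell lie within \<open>\<kappa> * s\<close> of one point of the graph,
  so the local count applies to each cell.\<close>

lemma card_points_near_curve_less:
  fixes \<phi> :: "real \<Rightarrow> real" and a b L \<gamma> c\<^sub>1 :: real
  assumes n: "n \<ge> 1" and ab: "a < b" and J: "J \<subseteq> {a<..<b}"
    and L: "\<And>s t. s \<in> {a<..<b} \<Longrightarrow> t \<in> {a<..<b} \<Longrightarrow> \<bar>\<phi> s - \<phi> t\<bar> \<le> L * \<bar>s - t\<bar>" "L \<ge> 0"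
    and \<gamma>: "0 < \<gamma>" "\<gamma> < 1" and c1: "c\<^sub>1 > 0"
  shows "\<exists>c\<^sub>3>0. \<forall>Q\<ge>1. finite (points_near_curve c\<^sub>1 \<phi> n Q \<gamma> J) \<and>
           real (card (points_near_curve c\<^sub>1 \<phi> n Q \<gamma> J)) < c\<^sub>3 * Q powr (real n + 1 - \<gamma>)"
proof -
  define m where "m = (a + b) / 2"
  \<comment> \<open>Within a cell the first coordinates differ by at most \<open>s\<close>, and so
    \<open>\<phi>\<close> by at most \<open>L * s\<close>; the second coordinates deviate by less
    than \<open>c\<^sub>1 * s\<close> more. The summand 1 also covers the first coordinates.\<close>
  define \<kappa> where "\<kappa> = c\<^sub>1 + L + 1"
  define B where "B = \<bar>a\<bar> + \<bar>b\<bar> + \<bar>\<phi> m\<bar> + L * (b - a) + \<kappa> + 1"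
  define C where "C = (real n + 1) * (real n)\<^sup>2 * B ^ n * \<kappa>"
  define D where "D = (real n)\<^sup>2 * (3 ^ (n - 1) * (2 * C + 1)\<^sup>2)"
  \<comment> \<open>The final summand 1 makes the upper bound strict even if \<open>D\<close>
    vanishes.\<close>
  define c\<^sub>3 where "c\<^sub>3 = (b - a + 1) * D + 1"
  have \<kappa>: "\<kappa> \<ge> 1" "c\<^sub>1 + L \<le> \<kappa>" using c1 L by (auto simp: \<kappa>_def)
  have La: "L * (b - a) \<ge> 0" using L ab by simp
  have B: "B \<ge> 1" unfolding B_def using \<kappa> La by auto
  have C: "C \<ge> 0" unfolding C_def using B \<kappa> by simp
  have D: "D \<ge> 0" unfolding D_def by simp
  have c3: "c\<^sub>3 > 0" unfolding c\<^sub>3_def using D ab by (simp add: add_nonneg_pos)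
  have bnd: "\<bar>t\<bar> + \<kappa> \<le> B \<and> \<bar>\<phi> t\<bar> + \<kappa> \<le> B" if t: "t \<in> {a<..<b}" for t
  proof -
    have "m \<in> {a<..<b}" using ab by (simp add: m_def)
    then have "\<bar>\<phi> t - \<phi> m\<bar> \<le> L * \<bar>t - m\<bar>" using L(1) t by blast
    also have "\<dots> \<le> L * (b - a)" using t ab L(2) by (intro mult_left_mono) (auto simp: m_def abs_if field_simps)
    finally show ?thesis using t La unfolding B_def by auto
  qed
  have main: "finite (points_near_curve c\<^sub>1 \<phi> n Q \<gamma> J) \<and>
      real (card (points_near_curve c\<^sub>1 \<phi> n Q \<gamma> J)) < c\<^sub>3 * Q powr (real n + 1 - \<gamma>)" if Q: "Q \<ge> 1" for Q
  proof -
    define s where "s = Q powr (- \<gamma>)"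
    have s: "0 < s" "s \<le> 1" using Q \<gamma> by (auto simp: s_def powr_minus inverse_le_1_iff ge_one_powr_ge_zero)
    have Qs: "Q * s = Q powr (1 - \<gamma>)" using Q by (simp add: s_def powr_diff powr_minus divide_inverse)
    have Qs1: "Q * s \<ge> 1" unfolding Qs using Q \<gamma> by (simp add: ge_one_powr_ge_zero)
    let ?M = "points_near_curve c\<^sub>1 \<phi> n Q \<gamma> J"
    define k where "k = (\<lambda>\<alpha>::complex\<times>complex. nat \<lfloor>(Re (fst \<alpha>) - a) / s\<rfloor>)"
    define K where "K = nat \<lfloor>(b - a) / s\<rfloor>"
    define cell where "cell = (\<lambda>i. {\<alpha> \<in> ?M. k \<alpha> = i})"
    have Md: "fst \<alpha> = of_real (Re (fst \<alpha>)) \<and> Re (fst \<alpha>) \<in> {a<..<b} \<and>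
        cmod (complex_of_real (\<phi> (Re (fst \<alpha>))) - snd \<alpha>) < c\<^sub>1 * s \<and> \<alpha> \<in> algebraic_points n Q"
      if "\<alpha> \<in> ?M" for \<alpha> using that J unfolding points_near_curve_def s_def by auto
    have cells: "finite (cell i) \<and> real (card (cell i)) \<le> D * (Q ^ (n - 1) * (Q * s)\<^sup>2)" for i
    proof (cases "cell i = {}")
      case True
      then show ?thesis using D Q by simp
    next
      case False
      then obtain \<beta> where \<beta>: "\<beta> \<in> ?M" "k \<beta> = i" by (auto simp: cell_def)
      define x where "x = Re (fst \<beta>)"
      have x: "x \<in> {a<..<b}" using Md[OF \<beta>(1)] by (simp add: x_def)
      have \<rho>: "\<kappa> * s \<ge> 0" "\<kappa> * s \<le> \<kappa>" using \<kappa> s by (auto simp: mult_left_le)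
      have Bx: "\<bar>x\<bar> + \<kappa> * s \<le> B" "\<bar>\<phi> x\<bar> + \<kappa> * s \<le> B" using bnd[OF x] \<rho> by auto
      let ?Z = "{\<alpha> \<in> algebraic_points n Q. cmod (fst \<alpha> - of_real x) \<le> \<kappa> * s \<and> cmod (snd \<alpha> - of_real (\<phi> x)) \<le> \<kappa> * s}"
      note Z = card_algebraic_points_near_le[OF n Q Bx B \<rho>(1)]
      have "cell i \<subseteq> ?Z"
      proof
        fix \<alpha> assume "\<alpha> \<in> cell i"
        then have \<alpha>: "\<alpha> \<in> ?M" "k \<alpha> = k \<beta>" using \<beta> by (auto simp: cell_def)
        define t where "t = Re (fst \<alpha>)"
        have t: "t \<in> {a<..<b}" "fst \<alpha> = of_real t" "cmod (complex_of_real (\<phi> t) - snd \<alpha>) < c\<^sub>1 * s"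
          "\<alpha> \<in> algebraic_points n Q"
          using Md[OF \<alpha>(1)] by (auto simp: t_def)
        \<comment> \<open>Nonnegativity is needed because \<open>nat\<close> would identify all
          negative floors.\<close>
        have "0 \<le> (t - a) / s" "0 \<le> (x - a) / s" using t x s by auto
        moreover have "nat \<lfloor>(t - a) / s\<rfloor> = nat \<lfloor>(x - a) / s\<rfloor>" using \<alpha>(2) by (simp add: k_def t_def x_def)
        ultimately have "\<lfloor>(t - a) / s\<rfloor> = \<lfloor>(x - a) / s\<rfloor>" by (simp add: nat_eq_iff)
        then have "\<bar>(t - a) / s - (x - a) / s\<bar> \<le> 1" by linarith
        then have "\<bar>t - x\<bar> \<le> s" using s by (simp add: diff_divide_distrib[symmetric] divide_le_eq)
        then have "\<bar>\<phi> t - \<phi> x\<bar> \<le> L * s" using L(1)[OF t(1) x] L(2) by (meson mult_left_mono order_trans)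
        moreover have "cmod (snd \<alpha> - of_real (\<phi> x))
            \<le> cmod (snd \<alpha> - of_real (\<phi> t)) + cmod (of_real (\<phi> t) - of_real (\<phi> x))"
          using norm_triangle_ineq[of "snd \<alpha> - of_real (\<phi> t)" "of_real (\<phi> t) - of_real (\<phi> x)"] by simp
        moreover have "cmod (of_real (\<phi> t) - of_real (\<phi> x)) = \<bar>\<phi> t - \<phi> x\<bar>"
          by (metis norm_of_real of_real_diff)
        ultimately have "cmod (snd \<alpha> - of_real (\<phi> x)) \<le> (c\<^sub>1 + L) * s"
          using t(3) by (simp add: norm_minus_commute algebra_simps)
        also have "\<dots> \<le> \<kappa> * s" using \<kappa> s by (intro mult_right_mono) auto
        finally have 1: "cmod (snd \<alpha> - of_real (\<phi> x)) \<le> \<kappa> * s" .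
        have "cmod (fst \<alpha> - of_real x) = \<bar>t - x\<bar>" unfolding t(2) by (metis norm_of_real of_real_diff)
        also have "\<dots> \<le> 1 * s" using \<open>\<bar>t - x\<bar> \<le> s\<close> by simp
        also have "\<dots> \<le> \<kappa> * s" using \<kappa> s by (intro mult_right_mono) auto
        finally show "\<alpha> \<in> ?Z" using 1 t(4) by simp
      qed
      then have "finite (cell i)" "card (cell i) \<le> card ?Z"
        using Z(1) by (auto intro: finite_subset card_mono)
      moreover have "real (card ?Z) \<le> D * (Q ^ (n - 1) * (Q * s)\<^sup>2)"
      proof -
        have "real (card ?Z) \<le> (real n)\<^sup>2 * ((3 * Q) ^ (n - 1) * (2 * (C * (Q * s)) + 1)\<^sup>2)"
          using Z(2) by (simp add: C_def mult_ac)
        \<comment> \<open>Here \<open>\<gamma> < 1\<close> enters: it gives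
          \<open>Q * s \<ge> 1\<close>, so the boundary term 1 in each interval count is
          absorbed.\<close>
        also have "\<dots> \<le> (real n)\<^sup>2 * ((3 * Q) ^ (n - 1) * ((2 * C + 1) * (Q * s))\<^sup>2)"
          using Q C Qs1 by (intro mult_left_mono power_mono) (auto simp: algebra_simps)
        also have "\<dots> = D * (Q ^ (n - 1) * (Q * s)\<^sup>2)" by (simp add: D_def power_mult_distrib mult_ac)
        finally show ?thesis .
      qed
      ultimately show ?thesis by linarith
    qed
    have Mun: "?M = (\<Union>i\<in>{..K}. cell i)"
    proof -
      have "k \<alpha> \<le> K" if "\<alpha> \<in> ?M" for \<alpha>
        using Md[OF that] s unfolding k_def K_def by (intro nat_mono floor_mono divide_right_mono) auto
      then show ?thesis by (auto simp: cell_def)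
    qed
    have fin: "finite ?M" unfolding Mun using cells by auto
    have "card ?M \<le> (\<Sum>i\<in>{..K}. card (cell i))" by (subst Mun) (intro card_UN_le finite_atMost)
    then have "real (card ?M) \<le> (\<Sum>i\<in>{..K}. real (card (cell i)))" by (metis of_nat_le_iff of_nat_sum)
    also have "\<dots> \<le> real (card {..K}) * (D * (Q ^ (n - 1) * (Q * s)\<^sup>2))"
      using cells by (intro sum_bounded_above) auto
    \<comment> \<open>There are \<open>K + 1\<close> cells, and the extra one is paid for by
      \<open>1 \<le> 1 / s\<close>.\<close>
    also have "\<dots> \<le> ((b - a + 1) / s) * (D * (Q ^ (n - 1) * (Q * s)\<^sup>2))"
    proof (rule mult_right_mono)
      have "real K \<le> (b - a) / s" unfolding K_def using ab s by simp
      moreover have "1 \<le> 1 / s" using s by simp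
      ultimately show "real (card {..K}) \<le> (b - a + 1) / s" by (simp add: add_divide_distrib)
    qed (use D Q in simp)
    also have "\<dots> = (b - a + 1) * D * (Q ^ (n - 1) * (Q\<^sup>2 * s))"
      using s by (simp add: power2_eq_square)
    also have "Q ^ (n - 1) * (Q\<^sup>2 * s) = Q powr (real n + 1 - \<gamma>)"
    proof -
      have "Q ^ (n - 1) * (Q\<^sup>2 * s) = Q ^ (n + 1) * s" using n by (simp flip: power_add mult.assoc)
      also have "\<dots> = Q powr (real (n + 1)) * Q powr (- \<gamma>)"
        using Q powr_realpow[of Q "n + 1"] by (simp only: s_def)
      also have "\<dots> = Q powr (real n + 1 - \<gamma>)" by (simp flip: powr_add add: add.commute)
      finally show ?thesis .
    qed
    also have "(b - a + 1) * D * Q powr (real n + 1 - \<gamma>) < c\<^sub>3 * Q powr (real n + 1 - \<gamma>)"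
      using Q by (intro mult_strict_right_mono) (auto simp: c\<^sub>3_def)
    finally show ?thesis using fin by blast
  qed
  show ?thesis using main c3 by blast
qed

section \<open>Polynomials with prescribed nearby roots\<close>

text \<open>The divided difference of \<open>t\<^sup>j\<close> at \<open>x\<close>, \<open>x\<close> and \<open>y\<close>.\<close>

primrec divdiff2 :: "nat \<Rightarrow> real \<Rightarrow> real \<Rightarrow> real" where
  "divdiff2 0 x y = 0"
| "divdiff2 (Suc j) x y = real j * x ^ (j - 1) + y * divdiff2 j x y"

text \<open>Taylor's formula with an explicit second-order remainder. Having no intermediate point,
  it extends linearly from powers to polynomials, and its remainder can be bounded from below as
  well as from above.\<close>

lemma power_eq_divdiff2:
  "y ^ j = x ^ j + real j * x ^ (j - 1) * (y - x) + (y - x)\<^sup>2 * divdiff2 j x y"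
proof (induction j)
  case (Suc j)
  \<comment> \<open>At \<open>j = 0\<close> the exponent truncates to 0, but the factor
    \<open>real j\<close> makes both sides zero.\<close>
  have x: "real j * x ^ (j - 1) * x = real j * x ^ j" by (cases j) auto
  have "y ^ Suc j = y * (x ^ j + real j * x ^ (j - 1) * (y - x) + (y - x)\<^sup>2 * divdiff2 j x y)"
    using Suc by simp
  also have "\<dots> = x ^ Suc j + x ^ j * (y - x) + (real j * x ^ (j - 1) * x) * (y - x)
      + (y - x)\<^sup>2 * (real j * x ^ (j - 1) + y * divdiff2 j x y)"
    by (simp add: power2_eq_square algebra_simps)
  also have "\<dots> = x ^ Suc j + real (Suc j) * x ^ (Suc j - 1) * (y - x) + (y - x)\<^sup>2 * divdiff2 (Suc j) x y"
    unfolding x by (simp add: algebra_simps)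
  finally show ?case .
qed simp

lemma abs_divdiff2_le:
  assumes "\<bar>x\<bar> \<le> B" "\<bar>y\<bar> \<le> B" "1 \<le> B"
  shows "\<bar>divdiff2 j x y\<bar> \<le> (real j)\<^sup>2 * B ^ j"
proof (induction j)
  case (Suc j)
  have "\<bar>divdiff2 (Suc j) x y\<bar> \<le> real j * \<bar>x\<bar> ^ (j - 1) + \<bar>y\<bar> * \<bar>divdiff2 j x y\<bar>"
    by (simp add: abs_mult power_abs order_trans[OF abs_triangle_ineq])
  also have "\<dots> \<le> real j * B ^ (j - 1) + B * ((real j)\<^sup>2 * B ^ j)"
    using assms Suc by (intro add_mono mult_mono power_mono) auto
  also have "\<dots> \<le> real j * B ^ Suc j + B * ((real j)\<^sup>2 * B ^ j)"
    using assms(3) by (intro add_right_mono mult_left_mono power_increasing) auto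
  also have "\<dots> = (real j + (real j)\<^sup>2) * B ^ Suc j" by (simp add: algebra_simps)
  also have "\<dots> \<le> (real (Suc j))\<^sup>2 * B ^ Suc j"
    using assms(3) by (intro mult_right_mono) (auto simp: power2_eq_square algebra_simps)
  finally show ?case .
qed simp

lemma sum_power_eq_divdiff2:
  fixes c :: "nat \<Rightarrow> real"
  shows "(\<Sum>j\<le>n. c j * y ^ j) = (\<Sum>j\<le>n. c j * x ^ j) + (\<Sum>j\<le>n. c j * (real j * x ^ (j - 1))) * (y - x)
     + (y - x)\<^sup>2 * (\<Sum>j\<le>n. c j * divdiff2 j x y)"
proof -
  have "(\<Sum>j\<le>n. c j * y ^ j) = (\<Sum>j\<le>n. c j * x ^ j + c j * (real j * x ^ (j - 1)) * (y - x)
     + (y - x)\<^sup>2 * (c j * divdiff2 j x y))"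
    by (rule sum.cong[OF refl], subst power_eq_divdiff2[of y _ x]) (simp add: algebra_simps)
  then show ?thesis by (simp add: sum.distrib sum_distrib_left sum_distrib_right)
qed

text \<open>At \<open>x - h\<close> and \<open>x + h\<close> the linear Taylor term has size at
  least \<open>h * D\<close> and opposite signs. By \<open>big\<close> it dominates the value at
  \<open>x\<close> together with the quadratic remainder, so the intermediate value theorem gives a
  root.\<close>

lemma real_root_near:
  fixes c :: "nat \<Rightarrow> real"
  assumes c: "\<And>j. j \<le> n \<Longrightarrow> \<bar>c j\<bar> \<le> Q" and x: "\<bar>x\<bar> + h \<le> B" and h: "0 < h" and B: "1 \<le> B"
    and w: "\<bar>\<Sum>j\<le>n. c j * x ^ j\<bar> \<le> w"
    and D: "D \<le> \<bar>\<Sum>j\<le>n. c j * (real j * x ^ (j - 1))\<bar>"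
    and big: "w + h\<^sup>2 * (Q * ((real n + 1) * (real n)\<^sup>2 * B ^ n)) \<le> h * D"
  shows "\<exists>t. \<bar>t - x\<bar> \<le> h \<and> (\<Sum>j\<le>n. c j * t ^ j) = 0"
proof -
  define p where "p = (\<lambda>t. \<Sum>j\<le>n. c j * t ^ j)"
  define d where "d = (\<Sum>j\<le>n. c j * (real j * x ^ (j - 1)))"
  have cont: "continuous_on S p" for S unfolding p_def by (intro continuous_intros)
  have Q0: "0 \<le> Q" using c[of 0] by simp
  have near: "\<bar>p t - d * (t - x)\<bar> \<le> h * D" if t: "\<bar>t - x\<bar> = h" for t
  proof -
    have "\<bar>\<Sum>j\<le>n. c j * divdiff2 j x t\<bar> \<le> real (card {..n}) * (Q * ((real n)\<^sup>2 * B ^ n))"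
      unfolding real_norm_def[symmetric]
    proof (rule sum_norm_bound)
      fix j assume "j \<in> {..n}"
      then have j: "j \<le> n" by simp
      have "\<bar>divdiff2 j x t\<bar> \<le> (real j)\<^sup>2 * B ^ j" using x t h B by (intro abs_divdiff2_le) auto
      also have "\<dots> \<le> (real n)\<^sup>2 * B ^ n"
        using j B by (intro mult_mono power_mono power_increasing) auto
      finally show "norm (c j * divdiff2 j x t) \<le> Q * ((real n)\<^sup>2 * B ^ n)"
        using c[OF j] Q0 by (simp add: abs_mult mult_mono)
    qed
    then have "\<bar>(t - x)\<^sup>2 * (\<Sum>j\<le>n. c j * divdiff2 j x t)\<bar>
        \<le> h\<^sup>2 * (Q * ((real n + 1) * (real n)\<^sup>2 * B ^ n))"
      unfolding abs_mult abs_power2 using t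
      by (intro mult_mono) (auto simp: algebra_simps power2_eq_square simp flip: abs_mult_self_eq[of "t - x"])
    moreover have "p t = p x + d * (t - x) + (t - x)\<^sup>2 * (\<Sum>j\<le>n. c j * divdiff2 j x t)"
      unfolding p_def d_def by (rule sum_power_eq_divdiff2)
    ultimately show ?thesis using w big unfolding p_def by linarith
  qed
  have 1: "\<bar>p (x + h) - d * h\<bar> \<le> h * D" "\<bar>p (x - h) + d * h\<bar> \<le> h * D"
    using near[of "x + h"] near[of "x - h"] h by auto
  show ?thesis
  proof (cases "d \<ge> 0")
    case True
    then have "h * D \<le> d * h" using D h unfolding d_def[symmetric] by (simp add: mult.commute)
    then have "p (x - h) \<le> 0" "0 \<le> p (x + h)" using 1 by auto
    then have "\<exists>t\<ge>x - h. t \<le> x + h \<and> p t = 0" using h cont by (intro IVT') auto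
    then obtain t where "x - h \<le> t" "t \<le> x + h" "p t = 0" by blast
    then show ?thesis unfolding p_def by (intro exI[of _ t]) auto
  next
    case False
    then have "h * D \<le> (- d) * h"
      using D h mult_right_mono[of D "- d" h] unfolding d_def[symmetric] by (simp add: mult.commute)
    then have "p (x + h) \<le> 0" "0 \<le> p (x - h)" using 1 by auto
    then have "\<exists>t\<ge>x - h. t \<le> x + h \<and> p t = 0" using h cont by (intro IVT2') auto
    then obtain t where "x - h \<le> t" "t \<le> x + h" "p t = 0" by blast
    then show ?thesis unfolding p_def by (intro exI[of _ t]) auto
  qed
qed

text \<open>In P(y) = P(x) + d (y - x) + (y - x)^2 G the values at \<open>x\<close> and
  \<open>y\<close> are small, so a large G forces a large derivative d. The term t^2 contributes
  exactly \<open>c 2\<close> to G, at least \<open>2 * T * m\<close>, and the choice of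
  \<open>T\<close> keeps the higher terms below \<open>T * m\<close>.\<close>

lemma abs_derivative_ge:
  fixes c :: "nat \<Rightarrow> real"
  assumes n: "n \<ge> 2" and B: "\<bar>x\<bar> \<le> B" "\<bar>y\<bar> \<le> B" "1 \<le> B"
    and w: "\<bar>\<Sum>j\<le>n. c j * x ^ j\<bar> \<le> w" "\<bar>\<Sum>j\<le>n. c j * y ^ j\<bar> \<le> w"
    and c2: "2 * T * m \<le> c 2" and cj: "\<And>j. 3 \<le> j \<Longrightarrow> j \<le> n \<Longrightarrow> \<bar>c j\<bar> \<le> 3 * m"
    and T: "3 * real n ^ 3 * B ^ n \<le> T" and m: "0 \<le> m" and \<epsilon>: "0 < \<epsilon>" "\<epsilon> \<le> \<bar>x - y\<bar>"
  shows "\<epsilon> * (T * m) - 2 * w / \<epsilon> \<le> \<bar>\<Sum>j\<le>n. c j * (real j * x ^ (j - 1))\<bar>"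
proof -
  define d where "d = (\<Sum>j\<le>n. c j * (real j * x ^ (j - 1)))"
  define G where "G = (\<Sum>j\<le>n. c j * divdiff2 j x y)"
  have T0: "0 \<le> T" using T B by (smt (verit) mult_nonneg_nonneg of_nat_0_le_iff zero_le_power)
  have "{..n} = insert 0 (insert 1 (insert 2 {3..n}))" using n by auto
  then have G: "G = c 2 + (\<Sum>j\<in>{3..n}. c j * divdiff2 j x y)"
    unfolding G_def by (simp add: numeral_2_eq_2)
  have "\<bar>\<Sum>j\<in>{3..n}. c j * divdiff2 j x y\<bar> \<le> real (card {3..n}) * (3 * m * ((real n)\<^sup>2 * B ^ n))"
    unfolding real_norm_def[symmetric]
  proof (rule sum_norm_bound)
    fix j assume "j \<in> {3..n}"
    then have j: "3 \<le> j" "j \<le> n" by auto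
    have "\<bar>divdiff2 j x y\<bar> \<le> (real j)\<^sup>2 * B ^ j" using B by (intro abs_divdiff2_le) auto
    also have "\<dots> \<le> (real n)\<^sup>2 * B ^ n"
      using j B by (intro mult_mono power_mono power_increasing) auto
    finally show "norm (c j * divdiff2 j x y) \<le> 3 * m * ((real n)\<^sup>2 * B ^ n)"
      using cj[OF j] m unfolding real_norm_def abs_mult by (intro mult_mono) auto
  qed
  also have "\<dots> \<le> real n * (3 * m * ((real n)\<^sup>2 * B ^ n))"
    using m B by (intro mult_right_mono) auto
  also have "\<dots> = (3 * real n ^ 3 * B ^ n) * m" by (simp add: power2_eq_square power3_eq_cube)
  also have "\<dots> \<le> T * m" using T m by (rule mult_right_mono)
  finally have G1: "T * m \<le> G" using c2 unfolding G by linarith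
  have eq: "(\<Sum>j\<le>n. c j * y ^ j) = (\<Sum>j\<le>n. c j * x ^ j) + d * (y - x) + (y - x)\<^sup>2 * G"
    unfolding d_def G_def by (rule sum_power_eq_divdiff2)
  define e where "e = \<bar>x - y\<bar>"
  have e: "\<epsilon> \<le> e" "e > 0" using \<epsilon> by (auto simp: e_def)
  have "e\<^sup>2 * (T * m) \<le> e\<^sup>2 * G" using G1 by (intro mult_left_mono) auto
  moreover have "e\<^sup>2 * G = (y - x)\<^sup>2 * G" unfolding e_def by (simp add: power2_commute)
  moreover have "\<bar>d * (y - x)\<bar> = \<bar>d\<bar> * e" by (simp add: abs_mult e_def abs_minus_commute)
  ultimately have "e\<^sup>2 * (T * m) - 2 * w \<le> \<bar>d\<bar> * e" using eq w by linarith
  then have "e * (T * m) - 2 * w / e \<le> \<bar>d\<bar>" using e by (simp add: field_simps power2_eq_square)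
  moreover have "\<epsilon> * (T * m) \<le> e * (T * m)" using e T0 m by (intro mult_right_mono) auto
  moreover have "2 * w / e \<le> 2 * w / \<epsilon>" using e \<epsilon> w(1) by (intro divide_left_mono) auto
  ultimately show ?thesis unfolding d_def by linarith
qed

section \<open>Families of Eisenstein polynomials with roots near a given pair\<close>

lemma card_Sigma_ge:
  assumes "finite A" "\<And>x. x \<in> A \<Longrightarrow> finite (F x)" "\<And>x. x \<in> A \<Longrightarrow> c \<le> real (card (F x))"
  shows "real (card A) * c \<le> real (card (Sigma A F))"
proof -
  have "real (card A) * c \<le> (\<Sum>x\<in>A. real (card (F x)))"
    using sum_bounded_below[of A c "\<lambda>x. real (card (F x))"] assms by simp
  also have "\<dots> = real (card (Sigma A F))"
    using assms by (subst card_SigmaI) auto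
  finally show ?thesis .
qed

lemma content_eq_1I:
  fixes P :: "int poly"
  assumes "P \<noteq> 0" "\<And>q. prime q \<Longrightarrow> \<exists>j. \<not> q dvd coeff P j"
  shows "content P = 1"
proof (rule ccontr)
  assume "content P \<noteq> 1"
  then have "\<not> is_unit (content P)" unfolding is_unit_content_iff .
  moreover have "content P \<noteq> 0" using assms by simp
  ultimately obtain q where "q dvd content P" "prime q" using prime_divisor_exists by blast
  then show False using assms(2) by (meson content_dvd_coeff dvd_trans)
qed

text \<open>
  The sign condition on the coefficient of \<open>t\<^sup>2\<close> selects one of the two associates \<open>P\<close> and \<open>- P\<close>, which have
  the same roots.
\<close>

definition irreducible_roots_near :: "nat \<Rightarrow> real \<Rightarrow> real \<Rightarrow> real \<Rightarrow> real \<Rightarrow> int poly \<Rightarrow> bool" where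
  "irreducible_roots_near n Q h x y P \<longleftrightarrow>
     irreducible P \<and> degree P \<le> n \<and> (\<forall>j\<le>n. \<bar>real_of_int (coeff P j)\<bar> \<le> Q) \<and> coeff P 2 > 0 \<and>
     (\<exists>t. \<bar>t - x\<bar> \<le> h \<and> poly (map_poly of_int P) t = 0) \<and>
     (\<exists>t. \<bar>t - y\<bar> \<le> h \<and> poly (map_poly of_int P) t = 0)"

text \<open>Here \<open>m\<close> is the number of choices for each coefficient of degree at least
  2, \<open>N\<close> the length of the windows for the other two, and \<open>T\<close> the
  dominance of the coefficient of t^2. The hypothesis \<open>height\<close> keeps all coefficients
  below \<open>Q\<close>, \<open>logQ\<close> feeds the coprimality count, and \<open>big\<close> is
  the sign-change condition of \<open>real_root_near\<close>.\<close>

lemma many_irreducible_polys: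
  fixes x y B \<epsilon> Q h :: real and n m N T :: nat
  assumes n: "n \<ge> 2" and B: "\<bar>x\<bar> + 1 \<le> B" "\<bar>y\<bar> + 1 \<le> B" and \<epsilon>: "0 < \<epsilon>" "\<epsilon> \<le> \<bar>x - y\<bar>"
    and T: "3 * real n ^ 3 * B ^ n \<le> real T" and m: "m \<ge> 1" and N: "N \<ge> 1"
    and h: "0 < h" "h \<le> 1"
    and height: "2 * (real n)\<^sup>2 * (2 * real T + 3) * B ^ (n + 1) * real m + 4 * real N \<le> Q"
    and logQ: "8 * log 2 Q \<le> (real N)\<^sup>2"
    and big: "6 * real N * B + h\<^sup>2 * (Q * ((real n + 1) * (real n)\<^sup>2 * B ^ n))
      \<le> h * (\<epsilon> * (real T * real m) - 2 * (6 * real N * B) / \<epsilon>)"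
  shows "\<exists>\<P>. finite \<P> \<and> real m ^ (n - 1) * ((real N)\<^sup>2 / 4) \<le> real (card \<P>) \<and>
     (\<forall>P\<in>\<P>. irreducible_roots_near n Q h x y P)"
proof -
  have B1: "1 \<le> B" "\<bar>x\<bar> \<le> B" "\<bar>y\<bar> \<le> B" "\<bar>x\<bar> + h \<le> B" "\<bar>y\<bar> + h \<le> B" using B h by auto
  define H where "H = (2 * real T + 3) * real m"
  have H0: "0 \<le> H" by (simp add: H_def)
  \<comment> \<open>The shift by \<open>T * m\<close> at index 2 produces the dominating
    coefficient.\<close>
  define W where "W = (\<lambda>j::nat. if j = 2 then {int (T * m)..<int (T * m) + int m} else {0..<int m})"
  define F where "F = (\<Pi>\<^sub>E j\<in>{2..n}. W j)"
  \<comment> \<open>Even coefficients except for an odd leading one, as Eisenstein's criterion at 2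
    demands.\<close>
  define a where "a = (\<lambda>(f::nat \<Rightarrow> int) j. 2 * f j + (if j = n then 1 else 0))"
  \<comment> \<open>With linear and constant coefficients \<open>a1 f\<close>, \<open>a0 f\<close> the polynomial would vanish at \<open>x\<close> and \<open>y\<close>.\<close>
  define a1 where "a1 = (\<lambda>f. - (\<Sum>j\<in>{2..n}. real_of_int (a f j) * divdiff j x y))"
  define a0 where "a0 = (\<lambda>f. - (\<Sum>j\<in>{2..n}. real_of_int (a f j) * x ^ j) - a1 f * x)"
  \<comment> \<open>The windows put \<open>2 * v\<close> and \<open>4 * u + 2\<close> within
    \<open>2 * N\<close> and \<open>4 * N\<close> of the ideal values. A prime dividing the content
    divides the leading coefficient, so only the primes dividing \<open>a f n\<close> have to be
    excluded.\<close>
  define G where "G = (\<lambda>f. {(v, u) \<in> {\<lfloor>a1 f / 2\<rfloor>..<\<lfloor>a1 f / 2\<rfloor> + int N} \<times> {\<lfloor>a0 f / 4\<rfloor>..<\<lfloor>a0 f / 4\<rfloor> + int N}.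
           \<forall>q. prime q \<and> q dvd a f n \<longrightarrow> \<not> (q dvd 2 * v \<and> q dvd 4 * u + 2)})"
  define cf where "cf = (\<lambda>(f, v, u) j. if j = 0 then 4 * u + 2 else if j = 1 then 2 * v else a f j)"
  define mk where "mk = (\<lambda>z. \<Sum>j\<le>n. monom (cf z j) j :: int poly)"
  have coeff_mk: "coeff (mk z) j = (if j \<le> n then cf z j else 0)" for z j
    unfolding mk_def by (simp add: coeff_sum if_distrib cong: if_cong)
  have split: "(\<Sum>j\<le>n. g j) = g 0 + (g 1 + (\<Sum>j\<in>{2..n}. g j))" for g :: "nat \<Rightarrow> real"
  proof -
    have "{..n} = insert 0 (insert 1 {2..n})" using n by auto
    then show ?thesis by simp
  qed
  have a_bounds: "0 \<le> a f j \<and> real_of_int (a f j) \<le> H \<and> (j = 2 \<longrightarrow> 2 * real T * real m \<le> real_of_int (a f j))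
      \<and> (3 \<le> j \<longrightarrow> real_of_int (a f j) \<le> 3 * real m)" if f: "f \<in> F" and j: "2 \<le> j" "j \<le> n" for f j
  proof -
    have "f j \<in> W j" using f j by (auto simp: F_def)
    moreover have "j \<noteq> 2 \<longleftrightarrow> 3 \<le> j" using j by auto
    ultimately have *: "0 \<le> f j" "j = 2 \<Longrightarrow> int (T * m) \<le> f j \<and> f j + 1 \<le> int (T * m) + int m" "3 \<le> j \<Longrightarrow> f j + 1 \<le> int m"
      by (auto simp: W_def split: if_splits intro: order_trans[of 0 "int T * int m"])
    have 1: "real_of_int (a f j) \<le> 2 * real_of_int (f j) + 1" "2 * real_of_int (f j) \<le> real_of_int (a f j)" by (auto simp: a_def)
    have nonneg: "0 \<le> a f j" using *(1) by (simp add: a_def)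
    have Hm: "H = 2 * (real T * real m) + 3 * real m" by (simp add: H_def algebra_simps)
    have Tm: "0 \<le> real T * real m" "1 \<le> real m" using m by auto
    show ?thesis
    proof (cases "j = 2")
      case True
      with *(2) have "real_of_int (int (T * m)) \<le> real_of_int (f j)" "real_of_int (f j + 1) \<le> real_of_int (int (T * m) + int m)"
        by (simp_all only: of_int_le_iff)
      then have "2 * real T * real m \<le> real_of_int (a f j)" "real_of_int (a f j) \<le> H"
        unfolding Hm using 1 Tm by simp_all
      then show ?thesis using True nonneg by simp
    next
      case False
      with j *(3) have "real_of_int (f j + 1) \<le> real_of_int (int m)" by (simp only: of_int_le_iff)
      then have "real_of_int (a f j) \<le> 3 * real m" using 1 Tm by simp
      moreover have "3 * real m \<le> H" unfolding Hm using Tm by simp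
      ultimately show ?thesis using False nonneg by simp
    qed
  qed
  have Bpow: "B ^ j \<le> B ^ n" "1 \<le> B ^ n" if "j \<le> n" for j using B1 that by (auto intro: power_increasing)
  have a1_le: "\<bar>a1 f\<bar> \<le> real n * (H * (real n * B ^ n))" if f: "f \<in> F" for f
  proof -
    have "\<bar>\<Sum>j\<in>{2..n}. real_of_int (a f j) * divdiff j x y\<bar> \<le> real (card {2..n}) * (H * (real n * B ^ n))"
      unfolding real_norm_def[symmetric]
    proof (rule sum_norm_bound)
      fix j assume "j \<in> {2..n}"
      then have j: "2 \<le> j" "j \<le> n" by auto
      have "\<bar>divdiff j x y\<bar> \<le> real j * B ^ j" using norm_divdiff_le[of x B y j] B1 by simp
      also have "\<dots> \<le> real n * B ^ n" using j Bpow B1 by (intro mult_mono) auto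
      finally show "norm (real_of_int (a f j) * divdiff j x y) \<le> H * (real n * B ^ n)"
        using a_bounds[OF f j] H0 unfolding real_norm_def abs_mult by (intro mult_mono) auto
    qed
    also have "\<dots> \<le> real n * (H * (real n * B ^ n))" using H0 B1 by (intro mult_right_mono) auto
    finally show ?thesis by (simp add: a1_def)
  qed
  have a0_le: "\<bar>a0 f\<bar> \<le> real n * (H * B ^ n) + real n * (H * (real n * B ^ n)) * B" if f: "f \<in> F" for f
  proof -
    have "\<bar>\<Sum>j\<in>{2..n}. real_of_int (a f j) * x ^ j\<bar> \<le> real (card {2..n}) * (H * B ^ n)"
      unfolding real_norm_def[symmetric]
    proof (rule sum_norm_bound)
      fix j assume "j \<in> {2..n}"
      then have j: "2 \<le> j" "j \<le> n" by auto
      have "\<bar>x ^ j\<bar> \<le> B ^ j" unfolding power_abs using B1 by (intro power_mono) auto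
      also have "\<dots> \<le> B ^ n" using j Bpow by auto
      finally show "norm (real_of_int (a f j) * x ^ j) \<le> H * B ^ n"
        using a_bounds[OF f j] H0 unfolding real_norm_def abs_mult by (intro mult_mono) auto
    qed
    also have "\<dots> \<le> real n * (H * B ^ n)" using H0 B1 by (intro mult_right_mono) auto
    finally have "\<bar>\<Sum>j\<in>{2..n}. real_of_int (a f j) * x ^ j\<bar> \<le> real n * (H * B ^ n)" .
    moreover have "\<bar>a1 f * x\<bar> \<le> real n * (H * (real n * B ^ n)) * B"
      unfolding abs_mult using a1_le[OF f] B1 H0 by (intro mult_mono) auto
    ultimately show ?thesis unfolding a0_def by linarith
  qed
  \<comment> \<open>\<open>M\<close> bounds the high coefficients and \<open>a1 f\<close>, while
    \<open>a0 f\<close> is at most \<open>2 * M\<close>; with the window errors this is what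
    \<open>height\<close> allows for.\<close>
  define M where "M = (real n)\<^sup>2 * H * B ^ (n + 1)"
  have M_ge: "H \<le> M" "real n * (H * (real n * B ^ n)) \<le> M" "real n * (H * B ^ n) \<le> M"
      "real n * (H * (real n * B ^ n)) * B = M"
  proof -
    have "1 \<le> real n" using n by simp
    then have n1: "1 \<le> (real n)\<^sup>2" "real n \<le> (real n)\<^sup>2"
      by (auto simp: power2_eq_square intro: one_le_power[of "real n" 2, unfolded power2_eq_square])
    have Bn: "B ^ n \<le> B ^ (n + 1)" "1 \<le> B ^ (n + 1)" 
      using B1(1) power_increasing[of n "n + 1" B] one_le_power[of B "n + 1"] by auto
    have "1 * H * 1 \<le> M" unfolding M_def using n1 Bn H0 by (intro mult_mono) auto
    then show "H \<le> M" by simp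
    have "(real n)\<^sup>2 * H * B ^ n \<le> M" unfolding M_def using Bn H0 by (intro mult_left_mono) auto
    then show "real n * (H * (real n * B ^ n)) \<le> M" by (simp add: power2_eq_square mult_ac)
    have "real n * H * B ^ n \<le> M" unfolding M_def using n1 Bn B1 H0 by (intro mult_mono) auto
    then show "real n * (H * B ^ n) \<le> M" by (simp add: mult_ac)
    show "real n * (H * (real n * B ^ n)) * B = M" by (simp add: M_def power2_eq_square mult_ac)
  qed
  have MQ: "2 * M + 4 * real N \<le> Q" using height by (simp add: M_def H_def mult_ac)
  have M0: "0 \<le> M" using M_ge(1) H0 by linarith
  have good: "irreducible_roots_near n Q h x y (mk z)"
    if z: "z \<in> Sigma F G" for z
  proof -
    obtain f v u where z_eq: "z = (f, v, u)" by (cases z) auto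
    have f: "f \<in> F" and vu: "(v, u) \<in> G f" using z unfolding z_eq by auto
    have cop: "\<not> (q dvd 2 * v \<and> q dvd 4 * u + 2)" if "prime q" "q dvd a f n" for q
      using vu that unfolding G_def by blast
    have v: "\<lfloor>a1 f / 2\<rfloor> \<le> v" "v + 1 \<le> \<lfloor>a1 f / 2\<rfloor> + int N" and u: "\<lfloor>a0 f / 4\<rfloor> \<le> u" "u + 1 \<le> \<lfloor>a0 f / 4\<rfloor> + int N"
      using vu unfolding G_def by auto
    have v': "\<bar>real_of_int (2 * v) - a1 f\<bar> \<le> 2 * real N" using v N by (simp add: abs_le_iff) linarith
    have u': "\<bar>real_of_int (4 * u + 2) - a0 f\<bar> \<le> 4 * real N" using u N by (simp add: abs_le_iff) linarith
    have odd: "odd (a f n)" by (simp add: a_def)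
    have an: "coeff (mk z) n = a f n" using n by (simp add: coeff_mk cf_def z_eq)
    have deg: "degree (mk z) = n"
    proof (rule antisym)
      show "degree (mk z) \<le> n" by (rule degree_le) (simp add: coeff_mk)
      have "coeff (mk z) n \<noteq> 0" using odd an by auto
      then show "n \<le> degree (mk z)" by (rule le_degree)
    qed
    have cont: "content (mk z) = 1"
    proof (rule content_eq_1I)
      show "mk z \<noteq> 0" using deg n by auto
      fix q :: int assume q: "prime q"
      have "coeff (mk z) 1 = 2 * v" "coeff (mk z) 0 = 4 * u + 2" using n by (auto simp: coeff_mk cf_def z_eq)
      then show "\<exists>j. \<not> q dvd coeff (mk z) j" using cop[OF q] an by metis
    qed
    have irr: "irreducible (mk z)"
    proof (rule Eisenstein_irreducible[of 2])
      show "prime (2::int)" by simp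
      show "degree (mk z) > 0" using deg n by simp
      show "\<not> 2 dvd lead_coeff (mk z)" using odd an deg by simp
      show "2 dvd coeff (mk z) i" if "i < degree (mk z)" for i
        using that unfolding deg by (auto simp: coeff_mk cf_def z_eq a_def)
      have "\<not> (4::int) dvd 4 * u + 2" by presburger
      then show "\<not> 2\<^sup>2 dvd coeff (mk z) 0" by (simp add: coeff_mk cf_def z_eq)
    qed (rule cont)
    have hts: "\<bar>real_of_int (coeff (mk z) j)\<bar> \<le> Q" if j: "j \<le> n" for j
    proof -
      consider "j = 0" | "j = 1" | "2 \<le> j" by linarith
      then show ?thesis
      proof cases
        case 1
        then have "coeff (mk z) j = 4 * u + 2" by (simp add: coeff_mk cf_def z_eq)
        then show ?thesis using u' a0_le[OF f] M_ge MQ by linarith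
      next
        case 2
        then have "coeff (mk z) j = 2 * v" using j by (simp add: coeff_mk cf_def z_eq)
        then show ?thesis using v' a1_le[OF f] M_ge MQ M0 by linarith
      next
        case 3
        then have "coeff (mk z) j = a f j" using j by (simp add: coeff_mk cf_def z_eq)
        then show ?thesis using a_bounds[OF f 3 j] M_ge(1) MQ M0 by simp
      qed
    qed
    define c where "c = (\<lambda>j. real_of_int (coeff (mk z) j))"
    have c0: "c 0 = real_of_int (4 * u + 2)" and c1: "c 1 = real_of_int (2 * v)"
      and c2: "\<And>j. j \<in> {2..n} \<Longrightarrow> c j = real_of_int (a f j)"
      using n by (auto simp: c_def coeff_mk cf_def z_eq)
    have poly_c: "poly (map_poly of_int (mk z)) t = (\<Sum>j\<le>n. c j * t ^ j)" for t :: real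
      using poly_map_of_int_sum[of "mk z" n t] deg by (simp add: c_def)
    have w: "\<bar>\<Sum>j\<le>n. c j * t ^ j\<bar> \<le> 6 * real N * B" if t: "t = x \<or> t = y" for t
    proof -
      \<comment> \<open>With the ideal coefficients the polynomial vanishes at \<open>x\<close> by
        the choice of \<open>a0\<close>, and at \<open>y\<close> by the divided difference in
        \<open>a1\<close>. Only the rounding errors of the two low coefficients remain.\<close>
      have "(x - y) * (\<Sum>j\<in>{2..n}. real_of_int (a f j) * divdiff j x y)
          = (\<Sum>j\<in>{2..n}. real_of_int (a f j) * ((x - y) * divdiff j x y))"
        by (simp add: sum_distrib_left mult_ac)
      also have "\<dots> = (\<Sum>j\<in>{2..n}. real_of_int (a f j) * x ^ j) - (\<Sum>j\<in>{2..n}. real_of_int (a f j) * y ^ j)"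
        by (simp add: divdiff_mult right_diff_distrib sum_subtractf)
      finally have "(\<Sum>j\<in>{2..n}. real_of_int (a f j) * t ^ j) + a1 f * t + a0 f = 0"
        using t by (auto simp: a0_def a1_def algebra_simps)
      moreover have "(\<Sum>j\<le>n. c j * t ^ j) = c 0 + c 1 * t + (\<Sum>j\<in>{2..n}. real_of_int (a f j) * t ^ j)"
        using c2 by (simp add: split)
      ultimately have "(\<Sum>j\<le>n. c j * t ^ j) = (c 0 - a0 f) + (c 1 - a1 f) * t" by (simp add: algebra_simps)
      moreover have "\<bar>(c 1 - a1 f) * t\<bar> \<le> 2 * real N * B"
        unfolding abs_mult c1 using v' B1 t by (intro mult_mono) auto
      moreover have "\<bar>c 0 - a0 f\<bar> \<le> 4 * real N * B"
      proof -
        have "4 * real N * 1 \<le> 4 * real N * B" using B1 by (intro mult_left_mono) auto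
        then show ?thesis using u' unfolding c0 by linarith
      qed
      ultimately show ?thesis by linarith
    qed
    have c_2: "2 * real T * real m \<le> c 2" and c_j: "\<And>j. 3 \<le> j \<Longrightarrow> j \<le> n \<Longrightarrow> \<bar>c j\<bar> \<le> 3 * real m"
      using a_bounds[OF f] n c2 by auto
    \<comment> \<open>The roles of \<open>x\<close> and \<open>y\<close> are interchangeable: the
      derivative at either point is bounded below by means of the other.\<close>
    have root: "\<exists>t. \<bar>t - p\<bar> \<le> h \<and> (\<Sum>j\<le>n. c j * t ^ j) = 0"
      if pq: "p = x \<and> q = y \<or> p = y \<and> q = x" for p q
    proof (rule real_root_near)
      show "\<bar>c j\<bar> \<le> Q" if "j \<le> n" for j using hts[OF that] by (simp add: c_def)
      show "\<bar>p\<bar> + h \<le> B" "0 < h" "1 \<le> B" using B1 h pq by auto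
      show "\<bar>\<Sum>j\<le>n. c j * p ^ j\<bar> \<le> 6 * real N * B" using w pq by blast
      show "\<epsilon> * (real T * real m) - 2 * (6 * real N * B) / \<epsilon> \<le> \<bar>\<Sum>j\<le>n. c j * (real j * p ^ (j - 1))\<bar>"
      proof (rule abs_derivative_ge[where y = q])
        show "\<bar>\<Sum>j\<le>n. c j * p ^ j\<bar> \<le> 6 * real N * B" "\<bar>\<Sum>j\<le>n. c j * q ^ j\<bar> \<le> 6 * real N * B" using w pq by auto
        show "\<bar>p\<bar> \<le> B" "\<bar>q\<bar> \<le> B" "1 \<le> B" using B1 pq by auto
        show "\<epsilon> \<le> \<bar>p - q\<bar>" using \<epsilon> pq by auto
      qed (use n T \<epsilon> c_2 c_j in auto)
      show "6 * real N * B + h\<^sup>2 * (Q * ((real n + 1) * (real n)\<^sup>2 * B ^ n))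
        \<le> h * (\<epsilon> * (real T * real m) - 2 * (6 * real N * B) / \<epsilon>)" by (rule big)
    qed
    have "coeff (mk z) 2 > 0"
    proof -
      have "1 \<le> B ^ n" using B1 by (intro one_le_power) auto
      then have "3 * 1 * 1 \<le> 3 * real n ^ 3 * B ^ n" using n by (intro mult_mono) (auto intro: one_le_power)
      then have "real T \<ge> 1" using T by linarith
      then have "0 < 2 * real T * real m" using m by simp
      then show ?thesis using c_2 by (simp add: c_def)
    qed
    then show ?thesis using irr deg hts root[of x y] root[of y x] unfolding irreducible_roots_near_def poly_c by blast
  qed
  have finW: "finite (W j)" and cardW: "card (W j) = m" for j unfolding W_def by auto
  have finF: "finite F" unfolding F_def using finW by (intro finite_PiE) auto
  have cardF: "card F = m ^ (n - 1)" using n by (simp add: F_def card_PiE cardW)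
  have finG: "finite (G f)" for f
    by (rule finite_subset[of _ "{\<lfloor>a1 f / 2\<rfloor>..<\<lfloor>a1 f / 2\<rfloor> + int N} \<times> {\<lfloor>a0 f / 4\<rfloor>..<\<lfloor>a0 f / 4\<rfloor> + int N}"])
      (auto simp: G_def)
  have cardG: "(real N)\<^sup>2 / 4 \<le> real (card (G f))" if f: "f \<in> F" for f
    unfolding G_def
  proof (rule card_jointly_coprime_pairs_ge)
    show odd: "odd (a f n)" by (simp add: a_def)
    have "0 \<le> a f n" "real_of_int (a f n) \<le> H" using a_bounds[OF f n order_refl] by auto
    moreover have "a f n \<noteq> 0" using odd by auto
    ultimately show pos: "0 < a f n" by linarith
    have "real_of_int (a f n) \<le> Q" using \<open>real_of_int (a f n) \<le> H\<close> M_ge(1) MQ M0 by linarith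
    then have "log 2 (real_of_int (a f n)) \<le> log 2 Q" using pos by simp
    then show "8 * log 2 (real_of_int (a f n)) \<le> (real N)\<^sup>2" using logQ by linarith
  qed
  have inj: "inj_on mk (Sigma F G)"
  proof
    fix z z' assume zz: "z \<in> Sigma F G" "z' \<in> Sigma F G" "mk z = mk z'"
    obtain f v u f' v' u' where z: "z = (f, v, u)" "z' = (f', v', u')" by (cases z; cases z') auto
    have ff: "f \<in> F" "f' \<in> F" using zz z by auto
    have co: "cf z j = cf z' j" if "j \<le> n" for j using arg_cong[OF zz(3), of "\<lambda>P. coeff P j"] that by (simp add: coeff_mk)
    have "u = u'" "v = v'" using co[of 0] co[of 1] n by (auto simp: cf_def z)
    moreover have "f = f'"
    proof (rule PiE_ext[OF ff[unfolded F_def]])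
      fix j assume "j \<in> {2..n}"
      then show "f j = f' j" using co[of j] by (auto simp: cf_def z a_def)
    qed
    ultimately show "z = z'" by (simp add: z)
  qed
  show ?thesis
  proof (intro exI[of _ "mk ` Sigma F G"] conjI)
    show "finite (mk ` Sigma F G)" using finF finG by auto
    have "real (card F) * ((real N)\<^sup>2 / 4) \<le> real (card (Sigma F G))"
      using finF finG cardG by (rule card_Sigma_ge)
    then show "real m ^ (n - 1) * ((real N)\<^sup>2 / 4) \<le> real (card (mk ` Sigma F G))"
      using inj by (simp add: card_image cardF)
  qed (use good in blast)
qed

text \<open>The parameters are \<open>m\<close> of order \<open>Q\<close>, \<open>N\<close> of order
  \<open>Q powr (1 - \<gamma>)\<close> and \<open>h = K * Q powr (- \<gamma>)\<close>; the exponent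
  is (n - 1) + 2 (1 - gamma). The threshold for \<open>Q\<close> is uniform in \<open>x\<close> and
  \<open>y\<close>.\<close>

lemma eventually_many_irreducible_polys:
  fixes B \<epsilon> \<gamma> :: real and n :: nat
  assumes n: "n \<ge> 2" and B: "1 \<le> B" and \<epsilon>: "0 < \<epsilon>" and \<gamma>: "0 < \<gamma>" "\<gamma> < 1"
  shows "\<exists>K>0. \<exists>\<delta>>0. \<forall>\<^sub>F Q in at_top. \<forall>x y. \<bar>x\<bar> + 1 \<le> B \<and> \<bar>y\<bar> + 1 \<le> B \<and> \<epsilon> \<le> \<bar>x - y\<bar> \<longrightarrow>
    (\<exists>\<P>. finite \<P> \<and> \<delta> * Q powr (real n + 1 - 2 * \<gamma>) \<le> real (card \<P>) \<and>
     (\<forall>P\<in>\<P>. irreducible_roots_near n Q (K * Q powr (- \<gamma>)) x y P))"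
proof -
  define T where "T = nat \<lceil>3 * real n ^ 3 * B ^ n\<rceil>"
  have T: "3 * real n ^ 3 * B ^ n \<le> real T" unfolding T_def by linarith
  have "0 < 3 * real n ^ 3 * B ^ n" using n B by simp
  then have T0: "0 < real T" using T by linarith
  define H where "H = 2 * (real n)\<^sup>2 * (2 * real T + 3) * B ^ (n + 1)"
  have H: "0 < H" unfolding H_def using n B T0 by simp
  define C where "C = (real n + 1) * (real n)\<^sup>2 * B ^ n"
  \<comment> \<open>As \<open>m\<close> will be at least \<open>Q / (4 * H)\<close>, the main term
    of the derivative bound is at least \<open>2 * d * Q\<close>; half of it survives the error
    term.\<close>
  define d where "d = \<epsilon> * real T / (8 * H)"
  have d: "0 < d" unfolding d_def using \<epsilon> T0 H by simp
  \<comment> \<open>Chosen so that \<open>h * (d * Q) = 24 * B * q\<close>, which pays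
    \<open>12 * B * q\<close> each for the value of the polynomial and the quadratic
    remainder.\<close>
  define K where "K = 24 * B / d"
  have K: "0 < K" unfolding K_def using B d by simp
  define \<delta> where "\<delta> = (1 / (4 * H)) ^ (n - 1) / 4"
  have \<delta>: "0 < \<delta>" unfolding \<delta>_def using H by simp
  \<comment> \<open>In order: room for \<open>4 * N\<close> in the height, the coprimality count,
    \<open>h \<le> 1\<close>, the derivative error, the quadratic remainder,
    \<open>m \<ge> 1\<close>, and positivity of \<open>Q\<close>.\<close>
  have e1: "\<forall>\<^sub>F Q in at_top. 8 * Q powr (1 - \<gamma>) \<le> Q / 2" using \<gamma> by real_asymp
  have e2: "\<forall>\<^sub>F Q in at_top. 8 * log 2 Q \<le> (Q powr (1 - \<gamma>))\<^sup>2" using \<gamma> by real_asymp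
  have e3: "\<forall>\<^sub>F Q in at_top. K * Q powr (- \<gamma>) \<le> 1" using \<gamma> by real_asymp
  have e4: "\<forall>\<^sub>F Q in at_top. 24 * B / \<epsilon> * Q powr (1 - \<gamma>) \<le> d * Q" using \<gamma> d by real_asymp
  have e5: "\<forall>\<^sub>F Q in at_top. K\<^sup>2 * C * Q powr (- \<gamma>) \<le> 12 * B" using \<gamma> B by real_asymp
  have e6: "\<forall>\<^sub>F Q in at_top. 4 * H \<le> Q" by real_asymp
  have e7: "\<forall>\<^sub>F Q in at_top. (1::real) \<le> Q" by real_asymp
  show ?thesis
  proof (rule exI[of _ K], intro conjI K, rule exI[of _ \<delta>], intro conjI \<delta>,
      use e1 e2 e3 e4 e5 e6 e7 in eventually_elim, intro allI impI)
    fix Q x y :: real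
    assume Q: "8 * Q powr (1 - \<gamma>) \<le> Q / 2" "8 * log 2 Q \<le> (Q powr (1 - \<gamma>))\<^sup>2"
      "K * Q powr (- \<gamma>) \<le> 1" "24 * B / \<epsilon> * Q powr (1 - \<gamma>) \<le> d * Q"
      "K\<^sup>2 * C * Q powr (- \<gamma>) \<le> 12 * B" "4 * H \<le> Q" "1 \<le> Q"
    assume xy: "\<bar>x\<bar> + 1 \<le> B \<and> \<bar>y\<bar> + 1 \<le> B \<and> \<epsilon> \<le> \<bar>x - y\<bar>"
    define q where "q = Q powr (1 - \<gamma>)"
    define h where "h = K * Q powr (- \<gamma>)"
    define N where "N = nat \<lceil>q\<rceil>"
    define m where "m = nat \<lfloor>Q / (2 * H)\<rfloor>"
    have Qq: "Q * Q powr (- \<gamma>) = q"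
      using Q(7) by (simp add: q_def powr_diff powr_minus divide_inverse)
    have q1: "1 \<le> q" unfolding q_def using Q(7) \<gamma> by (simp add: ge_one_powr_ge_zero)
    have N: "q \<le> real N" "real N \<le> 2 * q" "N \<ge> 1" using q1 unfolding N_def by linarith+
    define r where "r = Q / (2 * H)"
    have "2 \<le> r" using Q(6) H by (simp add: r_def field_simps)
    then have "m \<ge> 1" "real m \<le> r" "r / 2 \<le> real m" unfolding m_def r_def[symmetric] by linarith+
    then have m: "m \<ge> 1" "H * real m \<le> Q / 2" "Q / (4 * H) \<le> real m"
      using H by (simp_all add: r_def field_simps)
    have dm: "2 * d * Q \<le> \<epsilon> * (real T * real m)"
    proof -
      have "2 * d * Q = \<epsilon> * real T * (Q / (4 * H))" using H by (simp add: d_def field_simps)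
      also have "\<dots> \<le> \<epsilon> * real T * real m" using m(3) \<epsilon> by (intro mult_left_mono) auto
      finally show ?thesis by (simp add: mult_ac)
    qed
    have NB: "real N * B \<le> 2 * q * B" using N(2) B by (intro mult_right_mono) auto
    have "2 * (6 * real N * B) / \<epsilon> \<le> 24 * B / \<epsilon> * q"
      using NB \<epsilon> by (simp add: divide_right_mono field_simps)
    then have D: "d * Q \<le> \<epsilon> * (real T * real m) - 2 * (6 * real N * B) / \<epsilon>"
      using Q(4) dm unfolding q_def[symmetric] by linarith
    have h: "0 < h" "h \<le> 1" using K Q(3,7) by (auto simp: h_def)
    have hQ: "h * Q = K * q" using Qq by (simp add: h_def mult_ac)
    have "6 * real N * B + h\<^sup>2 * (Q * C) \<le> 12 * B * q + 12 * B * q"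
    proof (rule add_mono)
      show "6 * real N * B \<le> 12 * B * q" using NB by (simp add: mult_ac)
      have "h\<^sup>2 * (Q * C) = (h * Q) * (h * C)" by (simp add: power2_eq_square)
      also have "\<dots> = (K\<^sup>2 * C * Q powr (- \<gamma>)) * q" unfolding hQ by (simp add: h_def power2_eq_square)
      also have "\<dots> \<le> 12 * B * q" using Q(5) q1 by (intro mult_right_mono) auto
      finally show "h\<^sup>2 * (Q * C) \<le> 12 * B * q" .
    qed
    also have "\<dots> = h * (d * Q)"
    proof -
      have "h * (d * Q) = d * (h * Q)" by simp
      also have "\<dots> = 24 * B * q" unfolding hQ using d by (simp add: K_def)
      finally show ?thesis by simp
    qed
    also have "\<dots> \<le> h * (\<epsilon> * (real T * real m) - 2 * (6 * real N * B) / \<epsilon>)"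
      using D h by (intro mult_left_mono) auto
    finally have big: "6 * real N * B + h\<^sup>2 * (Q * C) \<le> h * (\<epsilon> * (real T * real m) - 2 * (6 * real N * B) / \<epsilon>)" .
    have height: "H * real m + 4 * real N \<le> Q" using m(2) N(2) Q(1) unfolding q_def by linarith
    have "q\<^sup>2 \<le> (real N)\<^sup>2" using N(1) q1 by (intro power_mono) auto
    then have lg: "8 * log 2 Q \<le> (real N)\<^sup>2" using Q(2) unfolding q_def by linarith
    obtain \<P> where P: "finite \<P>" "real m ^ (n - 1) * ((real N)\<^sup>2 / 4) \<le> real (card \<P>)"
      "\<forall>P\<in>\<P>. irreducible_roots_near n Q h x y P"
      using many_irreducible_polys[OF n _ _ \<epsilon> _ T m(1) N(3) h height[unfolded H_def] lg big[unfolded C_def], of x y] xy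
      by blast
    have "\<delta> * Q powr (real n + 1 - 2 * \<gamma>) = (Q / (4 * H)) ^ (n - 1) * (q\<^sup>2 / 4)"
    proof -
      have "q\<^sup>2 = Q powr (2 - 2 * \<gamma>)" unfolding q_def power2_eq_square by (simp flip: powr_add)
      moreover have "Q ^ (n - 1) = Q powr real (n - 1)" using Q(7) by (simp add: powr_realpow)
      moreover have "Q powr real (n - 1) * Q powr (2 - 2 * \<gamma>) = Q powr (real n + 1 - 2 * \<gamma>)"
        using n by (simp flip: powr_add add: of_nat_diff algebra_simps)
      ultimately have "Q ^ (n - 1) * q\<^sup>2 = Q powr (real n + 1 - 2 * \<gamma>)" by simp
      then show ?thesis unfolding \<delta>_def by (simp add: power_divide)
    qed
    also have "\<dots> \<le> real m ^ (n - 1) * ((real N)\<^sup>2 / 4)"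
      using m(3) H Q(7) \<open>q\<^sup>2 \<le> (real N)\<^sup>2\<close> by (intro mult_mono power_mono) auto
    finally have "\<delta> * Q powr (real n + 1 - 2 * \<gamma>) \<le> real (card \<P>)" using P(2) by linarith
    then show "\<exists>\<P>. finite \<P> \<and> \<delta> * Q powr (real n + 1 - 2 * \<gamma>) \<le> real (card \<P>) \<and>
     (\<forall>P\<in>\<P>. irreducible_roots_near n Q (K * Q powr (- \<gamma>)) x y P)"
      using P(1,3) unfolding h_def by blast
  qed
qed

section \<open>The main theorem\<close>

text \<open>Nodes spaced \<open>3 * h\<close> apart each supply a family of polynomials, and each
  polynomial a point with coordinates within \<open>h\<close> of the node and its image. Finiteness
  is assumed because \<open>card\<close> is 0 on infinite sets; the upper bound supplies it
  later.\<close>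

lemma eventually_card_points_near_curve_gt:
  fixes \<phi> :: "real \<Rightarrow> real" and c d B L \<epsilon> \<gamma> :: real
  assumes n: "n \<ge> 2" and cd: "c < d" "{c..d} \<subseteq> J" and \<gamma>: "0 < \<gamma>" "\<gamma> < 1" and \<epsilon>: "0 < \<epsilon>"
    and L: "\<And>s t. s \<in> {c..d} \<Longrightarrow> t \<in> {c..d} \<Longrightarrow> \<bar>\<phi> s - \<phi> t\<bar> \<le> L * \<bar>s - t\<bar>" "L \<ge> 0"
    and B: "\<And>t. t \<in> {c..d} \<Longrightarrow> \<bar>t\<bar> + 1 \<le> B \<and> \<bar>\<phi> t\<bar> + 1 \<le> B"
    and sep: "\<And>t. t \<in> {c..d} \<Longrightarrow> \<epsilon> \<le> \<bar>t - \<phi> t\<bar>"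
  shows "\<exists>C>0. \<exists>c\<^sub>2>0. \<forall>\<^sub>F Q in at_top. \<forall>c\<^sub>1\<ge>C. finite (points_near_curve c\<^sub>1 \<phi> n Q \<gamma> J) \<longrightarrow>
     c\<^sub>2 * Q powr (real n + 1 - \<gamma>) < real (card (points_near_curve c\<^sub>1 \<phi> n Q \<gamma> J))"
proof -
  have "1 \<le> B" using B[of c] cd by auto
  from eventually_many_irreducible_polys[OF n this \<epsilon> \<gamma>]
  obtain K \<delta> where K: "0 < K" and \<delta>: "0 < \<delta>"
    and ev: "\<forall>\<^sub>F Q in at_top. \<forall>x y. \<bar>x\<bar> + 1 \<le> B \<and> \<bar>y\<bar> + 1 \<le> B \<and> \<epsilon> \<le> \<bar>x - y\<bar> \<longrightarrow>
    (\<exists>\<P>. finite \<P> \<and> \<delta> * Q powr (real n + 1 - 2 * \<gamma>) \<le> real (card \<P>) \<and>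
     (\<forall>P\<in>\<P>. irreducible_roots_near n Q (K * Q powr (- \<gamma>)) x y P))" by blast
  \<comment> \<open>Moving the first root by \<open>h\<close> changes \<open>\<phi>\<close> by at
    most \<open>L * h\<close>, and the second root is off by another \<open>h\<close>; the summand 1
    gives strictness.\<close>
  define C where "C = (L + 1) * K + 1"
  \<comment> \<open>At least \<open>(d - c) / (6 * h)\<close> nodes are available; the remaining
    factor 2 is spent on the strict inequality.\<close>
  define c\<^sub>2 where "c\<^sub>2 = (d - c) / (12 * K) * \<delta>"
  have C: "0 < C" unfolding C_def using L K by (simp add: add_nonneg_pos)
  have c2: "0 < c\<^sub>2" unfolding c\<^sub>2_def using cd K \<delta> by simp
  have e1: "\<forall>\<^sub>F Q in at_top. 2 * (K * Q powr (- \<gamma>)) < \<epsilon>" using \<gamma> \<epsilon> by real_asymp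
  have e2: "\<forall>\<^sub>F Q in at_top. 12 * (K * Q powr (- \<gamma>)) \<le> d - c" 
  proof -
    have "0 < d - c" using cd by simp
    then show ?thesis using \<gamma> by real_asymp
  qed
  have e3: "\<forall>\<^sub>F Q in at_top. (1::real) \<le> Q" by real_asymp
  show ?thesis
  proof (rule exI[of _ C], intro conjI C, rule exI[of _ c\<^sub>2], intro conjI c2,
      use ev e1 e2 e3 in eventually_elim, intro allI impI)
    fix Q c\<^sub>1 :: real
    define h where "h = K * Q powr (- \<gamma>)"
    assume polys: "\<forall>x y. \<bar>x\<bar> + 1 \<le> B \<and> \<bar>y\<bar> + 1 \<le> B \<and> \<epsilon> \<le> \<bar>x - y\<bar> \<longrightarrow>
    (\<exists>\<P>. finite \<P> \<and> \<delta> * Q powr (real n + 1 - 2 * \<gamma>) \<le> real (card \<P>) \<and>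
     (\<forall>P\<in>\<P>. irreducible_roots_near n Q (K * Q powr (- \<gamma>)) x y P))"
    assume "2 * (K * Q powr (- \<gamma>)) < \<epsilon>" "12 * (K * Q powr (- \<gamma>)) \<le> d - c" and Q: "1 \<le> Q"
    then have h: "2 * h < \<epsilon>" "12 * h \<le> d - c" "0 < h" using K by (auto simp: h_def)
    assume c1: "C \<le> c\<^sub>1" and fin: "finite (points_near_curve c\<^sub>1 \<phi> n Q \<gamma> J)"
    \<comment> \<open>Dropping one node keeps the \<open>h\<close>-neighbourhoods of all nodes
      inside \<open>{c..d}\<close>; as \<open>r \<ge> 4\<close>, at least \<open>r / 2\<close> nodes
      remain.\<close>
    define M where "M = nat \<lfloor>(d - c) / (3 * h)\<rfloor> - 1"
    define X where "X = (\<lambda>k::nat. c + 3 * h * real k)"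
    define r where "r = (d - c) / (3 * h)"
    have r: "4 \<le> r" "3 * h * r = d - c" using h by (auto simp: r_def field_simps)
    have M: "real M + 1 \<le> r" "r / 2 \<le> real M" unfolding M_def r_def[symmetric] using r(1) by linarith+
    have X: "X k \<in> {c + h..d - h}" if k: "k \<in> {1..M}" for k
    proof -
      have "3 * h * 1 \<le> 3 * h * real k" "3 * h * real k \<le> 3 * h * (r - 1)"
        using k M h by (auto intro!: mult_left_mono)
      moreover have "3 * h * (r - 1) = (d - c) - 3 * h" using r(2) by (simp add: algebra_simps)
      ultimately show ?thesis using h by (auto simp: X_def)
    qed
    have near_J: "t \<in> {c..d}" if "k \<in> {1..M}" "\<bar>t - X k\<bar> \<le> h" for k t using X[OF that(1)] that(2) by auto
    have "\<forall>k\<in>{1..M}. \<exists>\<P>. finite \<P> \<and> \<delta> * Q powr (real n + 1 - 2 * \<gamma>) \<le> real (card \<P>) \<and>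
     (\<forall>P\<in>\<P>. irreducible_roots_near n Q h (X k) (\<phi> (X k)) P)"
    proof
      fix k assume k: "k \<in> {1..M}"
      have "X k \<in> {c..d}" using near_J[OF k, of "X k"] h by simp
      then show "\<exists>\<P>. finite \<P> \<and> \<delta> * Q powr (real n + 1 - 2 * \<gamma>) \<le> real (card \<P>) \<and>
     (\<forall>P\<in>\<P>. irreducible_roots_near n Q h (X k) (\<phi> (X k)) P)"
        using polys[rule_format, of "X k" "\<phi> (X k)"] B sep unfolding h_def by blast
    qed
    from bchoice[OF this] obtain \<P> where
      fP: "\<And>k. k \<in> {1..M} \<Longrightarrow> finite (\<P> k)" and
      cP: "\<And>k. k \<in> {1..M} \<Longrightarrow> \<delta> * Q powr (real n + 1 - 2 * \<gamma>) \<le> real (card (\<P> k))" and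
      P: "\<And>k P. k \<in> {1..M} \<Longrightarrow> P \<in> \<P> k \<Longrightarrow>
        irreducible_roots_near n Q h (X k) (\<phi> (X k)) P" by blast
    define t1 where "t1 = (\<lambda>k P. SOME t. \<bar>t - X k\<bar> \<le> h \<and> poly (map_poly of_int P) t = 0)"
    define t2 where "t2 = (\<lambda>k P. SOME t. \<bar>t - \<phi> (X k)\<bar> \<le> h \<and> poly (map_poly of_int P) t = 0)"
    have t1: "\<bar>t1 k P - X k\<bar> \<le> h" "poly (map_poly of_int P) (t1 k P) = 0"
     and t2: "\<bar>t2 k P - \<phi> (X k)\<bar> \<le> h" "poly (map_poly of_int P) (t2 k P) = 0"
      if "k \<in> {1..M}" "P \<in> \<P> k" for k P
    proof -
      have "\<exists>t. \<bar>t - X k\<bar> \<le> h \<and> poly (map_poly of_int P) t = 0"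
        "\<exists>t. \<bar>t - \<phi> (X k)\<bar> \<le> h \<and> poly (map_poly of_int P) t = 0" using P[OF that] unfolding irreducible_roots_near_def by blast+
      from this[THEN someI_ex] show "\<bar>t1 k P - X k\<bar> \<le> h" "poly (map_poly of_int P) (t1 k P) = 0"
        "\<bar>t2 k P - \<phi> (X k)\<bar> \<le> h" "poly (map_poly of_int P) (t2 k P) = 0"
        unfolding t1_def t2_def by auto
    qed
    define \<Psi> where "\<Psi> = (\<lambda>(k, P). (complex_of_real (t1 k P), complex_of_real (t2 k P)))"
    let ?S = "Sigma {1..M} \<P>"
    have common: "common_root_poly (\<Psi> (k, P)) P" if "k \<in> {1..M}" "P \<in> \<P> k" for k P
      using t1(2)[OF that] t2(2)[OF that] by (simp add: \<Psi>_def common_root_poly_def poly_map_of_int_of_real)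
    have sub: "\<Psi> ` ?S \<subseteq> points_near_curve c\<^sub>1 \<phi> n Q \<gamma> J"
    proof
      fix \<alpha> assume "\<alpha> \<in> \<Psi> ` ?S"
      then obtain k P where \<alpha>: "\<alpha> = \<Psi> (k, P)" and kP: "k \<in> {1..M}" "P \<in> \<P> k" by blast
      define s where "s = t1 k P" define t where "t = t2 k P"
      have s: "\<bar>s - X k\<bar> \<le> h" and t: "\<bar>t - \<phi> (X k)\<bar> \<le> h" using t1[OF kP] t2[OF kP] by (auto simp: s_def t_def)
      have sJ: "s \<in> {c..d}" and XJ: "X k \<in> {c..d}" using near_J[OF kP(1)] s h by auto
      have "s \<noteq> t" using sep[OF XJ] s t h(1) by linarith
      then have alg: "\<Psi> (k, P) \<in> algebraic_points n Q"
        using P[OF kP] common[OF kP] unfolding irreducible_roots_near_def by (intro algebraic_pointsI[of P]) (auto simp: \<Psi>_def s_def t_def)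
      have "\<bar>\<phi> s - t\<bar> < c\<^sub>1 * Q powr (- \<gamma>)"
      proof -
        have "\<bar>\<phi> s - \<phi> (X k)\<bar> \<le> L * \<bar>s - X k\<bar>" by (rule L(1)[OF sJ XJ])
        also have "\<dots> \<le> L * h" using s L(2) by (rule mult_left_mono)
        finally have "\<bar>\<phi> s - t\<bar> \<le> L * h + h" using t by linarith
        also have "\<dots> = (L + 1) * K * Q powr (- \<gamma>)" by (simp add: h_def algebra_simps)
        also have "\<dots> < c\<^sub>1 * Q powr (- \<gamma>)" using c1 Q by (intro mult_strict_right_mono) (auto simp: C_def)
        finally show ?thesis .
      qed
      then have "cmod (complex_of_real (\<phi> s) - complex_of_real t) < c\<^sub>1 * Q powr (- \<gamma>)"
        by (metis norm_of_real of_real_diff)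
      then show "\<alpha> \<in> points_near_curve c\<^sub>1 \<phi> n Q \<gamma> J"
        unfolding \<alpha> using alg sJ cd(2) unfolding points_near_curve_def by (auto simp: \<Psi>_def s_def t_def)
    qed
    have inj: "inj_on \<Psi> ?S"
    proof
      fix z z' assume zz: "z \<in> ?S" "z' \<in> ?S" "\<Psi> z = \<Psi> z'"
      obtain k P k' P' where z: "z = (k, P)" "z' = (k', P')" by (cases z; cases z') auto
      have kP: "k \<in> {1..M}" "P \<in> \<P> k" and kP': "k' \<in> {1..M}" "P' \<in> \<P> k'" using zz z by auto
      have "t1 k P = t1 k' P'" using zz(3) by (simp add: \<Psi>_def z)
      \<comment> \<open>Equal first coordinates put two nodes within \<open>2 * h\<close>, less than
        their spacing, so the nodes coincide. The point then fixes the polynomial up to sign, and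
        the positive coefficient of t^2 fixes the sign.\<close>
      then have "\<bar>X k - X k'\<bar> \<le> 2 * h" using t1(1)[OF kP] t1(1)[OF kP'] by linarith
      moreover have "\<bar>X k - X k'\<bar> = 3 * h * \<bar>real k - real k'\<bar>"
        unfolding X_def using h by (simp add: abs_mult flip: right_diff_distrib)
      ultimately have "3 * h * \<bar>real k - real k'\<bar> < 3 * h * 1" using h by simp
      then have "\<bar>real k - real k'\<bar> < 1" using h by (simp add: mult_less_cancel_left_pos)
      then have k: "k = k'" by linarith
      have "common_root_poly (\<Psi> z) P" "common_root_poly (\<Psi> z) P'"
        using common[OF kP] common[OF kP'] zz(3) by (auto simp: z)
      then have "(minimal_poly (\<Psi> z) = P \<or> minimal_poly (\<Psi> z) = - P) \<and> (minimal_poly (\<Psi> z) = P' \<or> minimal_poly (\<Psi> z) = - P')"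
        using P[OF kP] P[OF kP'] irreducible_eq_minimal_poly unfolding irreducible_roots_near_def by blast
      then have "P = P' \<or> P = - P'" by (metis minus_minus)
      moreover have "coeff P 2 > 0" "coeff P' 2 > 0" using P[OF kP] P[OF kP'] by (auto simp: irreducible_roots_near_def)
      ultimately have "P = P'" by auto
      then show "z = z'" by (simp add: z k)
    qed
    have Qe: "Q powr \<gamma> * Q powr (real n + 1 - 2 * \<gamma>) = Q powr (real n + 1 - \<gamma>)"
      by (simp flip: powr_add)
    have "c\<^sub>2 * Q powr (real n + 1 - \<gamma>) < 2 * c\<^sub>2 * Q powr (real n + 1 - \<gamma>)" using c2 Q by simp
    also have "\<dots> = r / 2 * (\<delta> * Q powr (real n + 1 - 2 * \<gamma>))"
      unfolding Qe[symmetric] c\<^sub>2_def r_def h_def using K Q by (simp add: powr_minus field_simps)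
    also have "\<dots> \<le> real M * (\<delta> * Q powr (real n + 1 - 2 * \<gamma>))"
      using M(2) \<delta> by (intro mult_right_mono) auto
    also have "\<dots> \<le> real (card ?S)" using card_Sigma_ge[of "{1..M}" \<P>] fP cP by simp
    also have "card ?S = card (\<Psi> ` ?S)" using inj by (simp add: card_image)
    also have "\<dots> \<le> card (points_near_curve c\<^sub>1 \<phi> n Q \<gamma> J)" using sub fin by (intro card_mono)
    finally show "c\<^sub>2 * Q powr (real n + 1 - \<gamma>) < real (card (points_near_curve c\<^sub>1 \<phi> n Q \<gamma> J))" by simp
  qed
qed

text \<open>The threshold is chosen before \<open>c\<^sub>1\<close>, hence independent of it.
  Finiteness is asserted because \<open>card\<close> alone would not show it. A nonempty interior
  excludes empty and one-point intervals, over which the number of points stays bounded.\<close>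

theorem theorem1:
  fixes n :: nat and a b \<gamma> :: real and J :: "real set" and \<phi> \<phi>' :: "real \<Rightarrow> real"
  assumes "n \<ge> 2"
    and "a < b"
    and "\<And>x. x \<in> {a<..<b} \<Longrightarrow> (\<phi> has_real_derivative \<phi>' x) (at x)"
    and "continuous_on {a<..<b} \<phi>'"
    and "bdd_above ((\<lambda>x. \<bar>\<phi>' x\<bar>) ` {a<..<b})"
    and "finite {x \<in> {a<..<b}. \<phi> x = x}"
    and "J \<subseteq> {a<..<b}" and "is_interval J" and "interior J \<noteq> {}"
    and "0 < \<gamma>" and "\<gamma> < 1"
  shows "\<exists>C>0. \<exists>Q\<^sub>0\<ge>1. \<forall>c\<^sub>1\<ge>C. \<exists>c\<^sub>2>0. \<exists>c\<^sub>3>0. \<forall>Q>Q\<^sub>0.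
           finite (points_near_curve c\<^sub>1 \<phi> n Q \<gamma> J) \<and>
           c\<^sub>2 * Q powr (real n + 1 - \<gamma>) < real (card (points_near_curve c\<^sub>1 \<phi> n Q \<gamma> J)) \<and>
           real (card (points_near_curve c\<^sub>1 \<phi> n Q \<gamma> J)) < c\<^sub>3 * Q powr (real n + 1 - \<gamma>)"
proof -
  obtain L where "\<forall>x\<in>{a<..<b}. \<bar>\<phi>' x\<bar> \<le> L"
    using assms(5) by (auto simp: bdd_above_def)
  then have L: "\<And>x. x \<in> {a<..<b} \<Longrightarrow> \<bar>\<phi>' x\<bar> \<le> L" by blast
  have L0: "L \<ge> 0" using L[of "(a + b) / 2"] \<open>a < b\<close> by (simp add: field_simps)
  have lip: "\<bar>\<phi> s - \<phi> t\<bar> \<le> L * \<bar>s - t\<bar>" if "s \<in> {a<..<b}" "t \<in> {a<..<b}" for s t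
  proof -
    have "norm (\<phi> s - \<phi> t) \<le> L * norm (s - t)"
      by (rule field_differentiable_bound[of "{a<..<b}" \<phi> \<phi>' L])
        (use assms(3) L that in \<open>auto intro: has_field_derivative_at_within\<close>)
    then show ?thesis by simp
  qed
  have cont: "isCont \<phi> x" if "x \<in> {a<..<b}" for x using assms(3)[OF that] by (rule DERIV_isCont)
  \<comment> \<open>A nonempty open set is infinite, so it contains a point that
    \<open>\<phi>\<close> does not fix; by continuity \<open>\<phi>\<close> stays away from the
    identity on a neighbourhood.\<close>
  have "infinite (interior J)"
    using assms(9) open_interior[of J] by (metis finite_imp_not_open)
  then have "\<not> interior J \<subseteq> {x \<in> {a<..<b}. \<phi> x = x}" using assms(6) finite_subset by blast
  then obtain x\<^sub>0 where x0: "x\<^sub>0 \<in> interior J" "\<phi> x\<^sub>0 \<noteq> x\<^sub>0" using interior_subset assms(7) by blast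
  have x0ab: "x\<^sub>0 \<in> {a<..<b}" using x0 interior_subset assms(7) by blast
  define \<epsilon> where "\<epsilon> = \<bar>x\<^sub>0 - \<phi> x\<^sub>0\<bar> / 2"
  have \<epsilon>: "\<epsilon> > 0" using x0 by (simp add: \<epsilon>_def)
  have "isCont (\<lambda>t. \<bar>t - \<phi> t\<bar>) x\<^sub>0" using cont[OF x0ab] by (intro continuous_intros)
  then have "((\<lambda>t. \<bar>t - \<phi> t\<bar>) \<longlongrightarrow> \<bar>x\<^sub>0 - \<phi> x\<^sub>0\<bar>) (at x\<^sub>0)" by (simp add: isCont_def)
  then have "\<forall>\<^sub>F t in at x\<^sub>0. \<epsilon> < \<bar>t - \<phi> t\<bar>" by (rule order_tendstoD) (use \<epsilon> in \<open>simp add: \<epsilon>_def\<close>)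
  then obtain r where r: "r > 0" "\<And>t. t \<noteq> x\<^sub>0 \<Longrightarrow> dist t x\<^sub>0 < r \<Longrightarrow> \<epsilon> < \<bar>t - \<phi> t\<bar>"
    by (auto simp: eventually_at)
  obtain e where e: "e > 0" "cball x\<^sub>0 e \<subseteq> interior J"
    using x0(1) open_interior[of J] by (meson open_contains_cball)
  define \<rho> where "\<rho> = min e (r / 2)"
  have \<rho>: "0 < \<rho>" "\<rho> \<le> e" "\<rho> < r" using e(1) r(1) by (auto simp: \<rho>_def)
  define c where "c = x\<^sub>0 - \<rho>"
  define d where "d = x\<^sub>0 + \<rho>"
  have cd: "c < d" using \<rho> by (simp add: c_def d_def)
  have sub: "{c..d} \<subseteq> J"
  proof -
    have "{c..d} \<subseteq> cball x\<^sub>0 e" using \<rho> by (auto simp: c_def d_def dist_real_def)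
    then show ?thesis using e interior_subset by blast
  qed
  have sep: "\<epsilon> \<le> \<bar>t - \<phi> t\<bar>" if t: "t \<in> {c..d}" for t
  proof (cases "t = x\<^sub>0")
    case True
    then show ?thesis by (simp add: \<epsilon>_def)
  next
    case False
    moreover have "dist t x\<^sub>0 < r" using t \<rho> by (auto simp: c_def d_def dist_real_def)
    ultimately show ?thesis using r(2) by force
  qed
  define B where "B = \<bar>c\<bar> + \<bar>d\<bar> + \<bar>\<phi> c\<bar> + L * (d - c) + 1"
  have cdab: "t \<in> {a<..<b}" if "t \<in> {c..d}" for t using that sub assms(7) by blast
  have B: "\<bar>t\<bar> + 1 \<le> B \<and> \<bar>\<phi> t\<bar> + 1 \<le> B" if t: "t \<in> {c..d}" for t
  proof -
    have "\<bar>\<phi> t - \<phi> c\<bar> \<le> L * \<bar>t - c\<bar>" using t cd by (intro lip cdab) auto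
    also have "\<dots> \<le> L * (d - c)" using t L0 by (intro mult_left_mono) auto
    finally have "\<bar>\<phi> t\<bar> \<le> \<bar>\<phi> c\<bar> + L * (d - c)" by linarith
    moreover have "0 \<le> L * (d - c)" using L0 cd by simp
    ultimately show ?thesis using t unfolding B_def by auto
  qed
  from eventually_card_points_near_curve_gt[OF assms(1) cd sub assms(10,11) \<epsilon> _ L0 B sep]
  obtain C c\<^sub>2 where C: "C > 0" and c2: "c\<^sub>2 > 0"
    and ev: "\<forall>\<^sub>F Q in at_top. \<forall>c\<^sub>1\<ge>C. finite (points_near_curve c\<^sub>1 \<phi> n Q \<gamma> J) \<longrightarrow>
      c\<^sub>2 * Q powr (real n + 1 - \<gamma>) < real (card (points_near_curve c\<^sub>1 \<phi> n Q \<gamma> J))"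
    using lip cdab by blast
  then obtain Q\<^sub>1 where Q1: "\<And>Q c\<^sub>1. Q \<ge> Q\<^sub>1 \<Longrightarrow> c\<^sub>1 \<ge> C \<Longrightarrow> finite (points_near_curve c\<^sub>1 \<phi> n Q \<gamma> J) \<Longrightarrow>
      c\<^sub>2 * Q powr (real n + 1 - \<gamma>) < real (card (points_near_curve c\<^sub>1 \<phi> n Q \<gamma> J))"
    by (auto simp: eventually_at_top_linorder)
  show ?thesis
  proof (rule exI[of _ C], intro conjI C, rule exI[of _ "max 1 Q\<^sub>1"], intro conjI allI impI)
    fix c\<^sub>1 assume c1: "c\<^sub>1 \<ge> C"
    \<comment> \<open>Only \<open>c\<^sub>3\<close> depends on \<open>c\<^sub>1\<close>;
      \<open>c\<^sub>2\<close> and the threshold serve all \<open>c\<^sub>1 \<ge> C\<close> at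
      once.\<close>
    obtain c\<^sub>3 where c3: "c\<^sub>3 > 0" "\<And>Q. Q \<ge> 1 \<Longrightarrow> finite (points_near_curve c\<^sub>1 \<phi> n Q \<gamma> J) \<and>
           real (card (points_near_curve c\<^sub>1 \<phi> n Q \<gamma> J)) < c\<^sub>3 * Q powr (real n + 1 - \<gamma>)"
      using card_points_near_curve_less[OF _ assms(2,7) lip L0 assms(10,11), of n c\<^sub>1] assms(1) c1 C by auto
    show "\<exists>c\<^sub>2>0. \<exists>c\<^sub>3>0. \<forall>Q>max 1 Q\<^sub>1. finite (points_near_curve c\<^sub>1 \<phi> n Q \<gamma> J) \<and>
           c\<^sub>2 * Q powr (real n + 1 - \<gamma>) < real (card (points_near_curve c\<^sub>1 \<phi> n Q \<gamma> J)) \<and>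
           real (card (points_near_curve c\<^sub>1 \<phi> n Q \<gamma> J)) < c\<^sub>3 * Q powr (real n + 1 - \<gamma>)"
      by (rule exI[of _ c\<^sub>2], intro conjI c2, rule exI[of _ c\<^sub>3], intro conjI c3(1))
        (use c3(2) Q1[OF _ c1] in auto)
  qed simp
qed

end
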